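(* Let $A=KQ_n/I$ be a Nakayama algebra, where $I=\langle g_1,\dots,g_k\rangle$ is an admissible ideal with minimal generating set of paths $\{g_1,\dots,g_k\}$. Let $\preceq$ be a total ordering on the set $\mathcal{S}$ of simple $A$-modules. Then $\preceq$ is a quasi-hereditary ordering of $A$ if and only if $\max Hod(g_i)\notin Int(g_i)$ for all $i=1,\dots,k$, where the maximum is taken with respect to $\preceq$.
   Context: $K$ is an algebraically closed field and $n\ge 2$. $Q_n$ denotes either the linear quiver $A_n$ with vertices $1,\dots,n$ and arrows $\alpha_j:j\to j+1$ ($1\le j\le n-1$), or the cyclic quiver $\widetilde{A}_n$ with vertices $1,\dots,n$ and arrows $\alpha_j:j\to j+1$ ($1\le j\le n-1$) and $\alpha_n:n\to 1$. A Nakayama algebra means a finite-dimensional algebra $A=KQ_n/I$ with $I$ an admissible two-sided ideal; $I$ is generated by a minimal set of paths, and writing $I=\langle g_1,\dots,g_k\rangle$ always means that $\{g_1,\dots,g_k\}$ is this minimal set of paths. Vertices are read modulo $n$ in the cyclic case. Paths compose from right to left, and modules are such that the indecomposable projective $P(j)$ with top $j$ is uniserial with composition factors $j,j+1,j+2,\dots$ from top to socle. The simple module at vertex $x$ is denoted by $x$, and $\mathcal{S}$ is the set of all simple $A$-modules, i.e. of vertices ($|\mathcal{S}|=n$). Length of a path means number of arrows plus $1$. For a path $g=\alpha_{d(g)-1}\cdots\alpha_{h(g)}$ of length $\ell_g\ge 3$ from vertex $h(g)$ (the hook of $g$) to vertex $d(g)=h(g)+\ell_g-1$ (the denouement of $g$),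 $Hod(g)$ is the multiset $\{h(g),h(g)+1,\dots,d(g)\}$ of the $\ell_g$ vertices visited by $g$, and $Int(g)$ is the multiset obtained from $Hod(g)$ by removing the first and last entries $h(g)$ and $d(g)$ (one occurrence each), so $|Int(g)|=\ell_g-2$. Given a total ordering $\preceq$ on $\mathcal{S}$, the Weyl module $\Delta(x)$ is the maximal factor module of $P(x)$ all of whose composition factors $y$ satisfy $y\preceq x$. A module is good if it has a finite filtration whose successive quotients are Weyl modules; $\mathscr{F}$ is the class of good modules. The ordering $\preceq$ is a quasi-hereditary ordering ($q$-ordering) of $A$ if for every $x\in\mathcal{S}$: (1) $\mathrm{End}_A(\Delta(x))\simeq K$, and (2) $P(x)\in\mathscr{F}$. *)

theory Defs
  imports
    "HOL-Algebra.Algebraic_Closure_Type"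
    "HOL-Algebra.Module"
    "HOL-Algebra.QuotRing"
    "HOL-Algebra.Ideal_Product"
    "HOL-Library.Multiset"
begin

section \<open>The quivers and their paths\<close>

datatype nak_quiver = LinearA nat | CyclicA nat

primrec verts :: "nak_quiver \<Rightarrow> nat set" where
  "verts (LinearA n) = {1..n}"
| "verts (CyclicA n) = {1..n}"

text \<open>For \<open>n \<ge> 2\<close> neither quiver has two arrows with the same source and target, so an arrow is
  given by the pair of its source and target.\<close>

primrec arrows :: "nak_quiver \<Rightarrow> (nat \<times> nat) set" where
  "arrows (LinearA n) = {(j, j + 1) |j. 1 \<le> j \<and> j < n}"
| "arrows (CyclicA n) = {(j, j + 1) |j. 1 \<le> j \<and> j < n} \<union> {(n, 1)}"

text \<open>A path is the nonempty list of the vertices it visits, in the order in which they are visited: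
  \<open>[x]\<close> is the trivial path \<open>e\<^sub>x\<close> and \<open>[h, h + 1, \<dots>, d]\<close> is
  \<open>\<alpha>\<^bsub>d-1\<^esub> \<cdots> \<alpha>\<^bsub>h\<^esub>\<close>. In particular the list length is the number of arrows plus 1.\<close>

definition paths :: "nak_quiver \<Rightarrow> nat list set" where
  "paths Q = {p. p \<noteq> [] \<and> set p \<subseteq> verts Q \<and> successively (\<lambda>i j. (i, j) \<in> arrows Q) p}"

definition Hod :: "nat list \<Rightarrow> nat multiset" where
  "Hod g = mset g"

definition Interior :: "nat list \<Rightarrow> nat multiset" where
  "Interior g = Hod g - {#hd g, last g#}"

text \<open>A total ordering of the vertices is a relation \<open>r\<close> with \<open>(y, x) \<in> r\<close> for \<open>y \<preceq> x\<close>.\<close>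

definition max_wrt :: "(nat \<times> nat) set \<Rightarrow> nat multiset \<Rightarrow> nat" where
  "max_wrt r V = (THE m. m \<in># V \<and> (\<forall>y\<in>#V. (y, m) \<in> r))"


section \<open>The path algebra and its quotients\<close>

text \<open>An element of \<open>KQ\<close> is a finitely supported function from paths to \<open>K\<close>. Paths compose from right
  to left: the factorisations of a path \<open>p\<close> as \<open>q s\<close> (first \<open>s\<close>, then \<open>q\<close>) are
  \<open>s = take (k + 1) p\<close>, \<open>q = drop k p\<close> for \<open>k < length p\<close>, the vertex \<open>p ! k\<close> being shared.\<close>

definition path_algebra :: "nak_quiver \<Rightarrow> (nat list \<Rightarrow> 'k::field) ring" where
  "path_algebra Q =
    \<lparr>carrier = {f. finite {p. f p \<noteq> 0} \<and> {p. f p \<noteq> 0} \<subseteq> paths Q},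
     monoid.mult = (\<lambda>f g p. \<Sum>k<length p. f (drop k p) * g (take (k + 1) p)),
     one = (\<lambda>p. if \<exists>x\<in>verts Q. p = [x] then 1 else 0),
     zero = (\<lambda>_. 0),
     add = (\<lambda>f g p. f p + g p)\<rparr>"

definition path_elem :: "nat list \<Rightarrow> nat list \<Rightarrow> 'k::field" where
  "path_elem q = (\<lambda>p. if p = q then 1 else 0)"

lemma paths_glue:
  assumes "k < length p" "drop k p \<in> paths Q" "take (k + 1) p \<in> paths Q"
  shows "p \<in> paths Q"
proof -
  define u v where "u = take k p" and "v = drop (Suc k) p"
  have p: "p = u @ [p!k] @ v" using assms(1) by (simp add: u_def v_def id_take_nth_drop)
  have d: "drop k p = p!k # v" using assms(1) by (simp add: v_def Cons_nth_drop_Suc)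
  have t: "take (k+1) p = u @ [p!k]" using assms(1) by (simp add: u_def take_Suc_conv_app_nth)
  show ?thesis using assms(2,3) unfolding d t
    apply (subst p) by (auto simp: paths_def successively_append_iff)
qed

lemma path_elem_mult:
  assumes "p \<noteq> []" "q \<noteq> []"
  shows "path_elem q \<otimes>\<^bsub>path_algebra Q\<^esub> path_elem p =
    (if last p = hd q then path_elem (p @ tl q) else (\<lambda>_. 0 :: 'k::field))"
proof
  fix s
  have *: "drop k s = q \<and> take (Suc k) s = p \<longleftrightarrow> k = length p - 1 \<and> last p = hd q \<and> s = p @ tl q" if "k < length s" for k
  proof
    assume a: "drop k s = q \<and> take (Suc k) s = p"
    then have "length p = Suc k" using that by auto
    moreover have "hd q = s ! k" "last p = s ! k" using a that by (auto simp: hd_drop_conv_nth take_Suc_conv_app_nth)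
    moreover have "s = p @ tl q" using a that append_take_drop_id[of "Suc k" s] 
      by (metis drop_Suc tl_drop)
    ultimately show "k = length p - 1 \<and> last p = hd q \<and> s = p @ tl q" by simp
  next
    assume a: "k = length p - 1 \<and> last p = hd q \<and> s = p @ tl q"
    then have k: "Suc k = length p" using assms by simp
    have "drop k (p @ tl q) = [last p] @ tl q" using k a assms
      by (metis append_butlast_last_id append.assoc append_eq_conv_conj length_butlast)
    then show "drop k s = q \<and> take (Suc k) s = p" using a k assms by simp
  qed
  have "(path_elem q \<otimes>\<^bsub>path_algebra Q\<^esub> path_elem p) s =
     (\<Sum>k<length s. if drop k s = q \<and> take (Suc k) s = p then 1 else (0::'k))"
    by (auto simp: path_algebra_def path_elem_def intro!: sum.cong)
  also have "\<dots> = (\<Sum>k<length s. if k = length p - 1 then (if last p = hd q \<and> s = p @ tl q then 1 else (0::'k)) else 0)"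
    by (intro sum.cong refl) (simp only: * lessThan_iff if_distrib cong: if_cong, auto)
  also have "\<dots> = (if last p = hd q then path_elem (p @ tl q) else (\<lambda>_. 0)) s"
    using assms by (cases "length p") (auto simp: path_elem_def sum.delta)
  finally show "(path_elem q \<otimes>\<^bsub>path_algebra Q\<^esub> path_elem p) s = (if last p = hd q then path_elem (p @ tl q) else (\<lambda>_. 0 :: 'k)) s" .
qed

lemma path_algebra_mult_closed:
  assumes "f \<in> carrier (path_algebra Q)" "g \<in> carrier (path_algebra Q)"
  shows "f \<otimes>\<^bsub>path_algebra Q\<^esub> g \<in> carrier (path_algebra Q)"
proof -
  let ?F = "{p. f p \<noteq> 0}" and ?G = "{p. g p \<noteq> 0}"
  have ex: "\<exists>k<length p. f (drop k p) \<noteq> 0 \<and> g (take (k+1) p) \<noteq> 0" 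
    if "(f \<otimes>\<^bsub>path_algebra Q\<^esub> g) p \<noteq> 0" for p
    using that by (auto simp: path_algebra_def elim!: sum.not_neutral_contains_not_neutral)
  have "{p. (f \<otimes>\<^bsub>path_algebra Q\<^esub> g) p \<noteq> 0} \<subseteq> (\<lambda>(q,s). s @ tl q) ` (?F \<times> ?G)"
  proof
    fix p assume "p \<in> {p. (f \<otimes>\<^bsub>path_algebra Q\<^esub> g) p \<noteq> 0}"
    then obtain k where "k<length p" "f (drop k p) \<noteq> 0" "g (take (k+1) p) \<noteq> 0" using ex by blast
    then show "p \<in> (\<lambda>(q,s). s @ tl q) ` (?F \<times> ?G)"
      by (intro image_eqI[of _ _ "(drop k p, take (k+1) p)"]) (auto simp: tl_drop simp flip: drop_Suc)
  qed
  moreover have "finite (?F \<times> ?G)" using assms by (simp add: path_algebra_def)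
  ultimately have "finite {p. (f \<otimes>\<^bsub>path_algebra Q\<^esub> g) p \<noteq> 0}" using finite_surj by blast
  moreover have "{p. (f \<otimes>\<^bsub>path_algebra Q\<^esub> g) p \<noteq> 0} \<subseteq> paths Q"
  proof
    fix p assume "p \<in> {p. (f \<otimes>\<^bsub>path_algebra Q\<^esub> g) p \<noteq> 0}"
    then obtain k where "k<length p" "f (drop k p) \<noteq> 0" "g (take (k+1) p) \<noteq> 0" using ex by blast
    then show "p \<in> paths Q" using assms by (intro paths_glue[of k p]) (auto simp: path_algebra_def)
  qed
  ultimately show ?thesis by (simp add: path_algebra_def)
qed

lemma path_algebra_mult_assoc: 
  "(f \<otimes>\<^bsub>path_algebra Q\<^esub> g) \<otimes>\<^bsub>path_algebra Q\<^esub> h = f \<otimes>\<^bsub>path_algebra Q\<^esub> (g \<otimes>\<^bsub>path_algebra Q\<^esub> h)"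
proof
  fix p
  let ?T = "\<lambda>k m. f (drop m p) * g (take (m - k + 1) (drop k p)) * h (take (k+1) p)"
  have "((f \<otimes>\<^bsub>path_algebra Q\<^esub> g) \<otimes>\<^bsub>path_algebra Q\<^esub> h) p
     = (\<Sum>k<length p. \<Sum>l<length p - k. ?T k (l + k))"
    by (simp add: path_algebra_def sum_distrib_right mult.assoc)
  also have "\<dots> = (\<Sum>k<length p. \<Sum>m\<in>{k..<length p}. ?T k m)"
  proof (rule sum.cong[OF refl])
    fix k show "(\<Sum>l<length p - k. ?T k (l + k)) = (\<Sum>m\<in>{k..<length p}. ?T k m)"
      by (rule sum.reindex_bij_witness[of _ "\<lambda>m. m - k" "\<lambda>l. l + k"]) auto
  qed
  also have "\<dots> = (\<Sum>m<length p. \<Sum>k\<le>m. ?T k m)"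
  proof -
    have "(\<Sum>x\<in>(SIGMA k:{..<length p}. {k..<length p}). case x of (k,m) \<Rightarrow> ?T k m) = (\<Sum>x\<in>(SIGMA m:{..<length p}. {..m}). case x of (m,k) \<Rightarrow> ?T k m)"
      by (rule sum.reindex_bij_witness[of _ "\<lambda>(m,k). (k,m)" "\<lambda>(k,m). (m,k)"]) auto
    then show ?thesis by (simp add: sum.Sigma)
  qed
  also have "\<dots> = (f \<otimes>\<^bsub>path_algebra Q\<^esub> (g \<otimes>\<^bsub>path_algebra Q\<^esub> h)) p"
  proof -
    have "(f \<otimes>\<^bsub>path_algebra Q\<^esub> (g \<otimes>\<^bsub>path_algebra Q\<^esub> h)) p = 
      (\<Sum>m<length p. \<Sum>k<Suc m. f (drop m p) * (g (drop k (take (Suc m) p)) * h (take (Suc k) (take (Suc m) p))))"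
      by (simp add: path_algebra_def sum_distrib_left min_absorb2 del: sum.lessThan_Suc)
    also have "\<dots> = (\<Sum>m<length p. \<Sum>k\<le>m. ?T k m)"
      by (auto simp: lessThan_Suc_atMost drop_take Suc_diff_le min_absorb1 mult.assoc intro!: sum.cong simp del: sum.lessThan_Suc)
    finally show ?thesis by simp
  qed
  finally show "((f \<otimes>\<^bsub>path_algebra Q\<^esub> g) \<otimes>\<^bsub>path_algebra Q\<^esub> h) p = (f \<otimes>\<^bsub>path_algebra Q\<^esub> (g \<otimes>\<^bsub>path_algebra Q\<^esub> h)) p" .
qed

lemma finite_verts: "finite (verts Q)" by (cases Q) auto

lemma path_algebra_ring: "ring (path_algebra Q :: (nat list \<Rightarrow> 'k::field) ring)"
proof -
  let ?R = "path_algebra Q :: (nat list \<Rightarrow> 'k) ring"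
  have addc: "f \<oplus>\<^bsub>?R\<^esub> g \<in> carrier ?R" if "f \<in> carrier ?R" "g \<in> carrier ?R" for f g
  proof -
    have "{p. f p + g p \<noteq> 0} \<subseteq> {p. f p \<noteq> 0} \<union> {p. g p \<noteq> 0}" by auto
    then show ?thesis using that finite_subset[of "{p. f p + g p \<noteq> 0}" "{p. f p \<noteq> 0} \<union> {p. g p \<noteq> 0}"] 
      by (auto simp: path_algebra_def)
  qed
  have one_eq: "{p. \<exists>x\<in>verts Q. p = [x]} = (\<lambda>x. [x]) ` verts Q" by auto
  have onec: "\<one>\<^bsub>?R\<^esub> \<in> carrier ?R"
    using finite_verts[of Q] by (auto simp: path_algebra_def one_eq paths_def)
  show ?thesis
  proof (rule ringI)
    show "abelian_group ?R"
    proof (rule abelian_groupI)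
      fix f assume f: "f \<in> carrier ?R"
      show "\<exists>g\<in>carrier ?R. g \<oplus>\<^bsub>?R\<^esub> f = \<zero>\<^bsub>?R\<^esub>"
        using f by (intro bexI[of _ "\<lambda>p. - f p"]) (auto simp: path_algebra_def)
    qed (use addc in \<open>auto simp: path_algebra_def add_ac\<close>)
    show "Group.monoid ?R"
    proof (rule Group.monoidI)
      fix f assume f: "f \<in> carrier ?R"
      have f0: "f [] = 0" using f by (auto simp: path_algebra_def paths_def)
      have inV: "f p = 0" if "\<not> set p \<subseteq> verts Q" for p using that f by (auto simp: path_algebra_def paths_def)
      show "\<one>\<^bsub>?R\<^esub> \<otimes>\<^bsub>?R\<^esub> f = f"
      proof
        fix p
        have "(\<one>\<^bsub>?R\<^esub> \<otimes>\<^bsub>?R\<^esub> f) p = (\<Sum>k<length p. if k = length p - 1 then f p else 0)"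
          unfolding path_algebra_def monoid.simps ring.simps partial_object.simps
        proof (intro sum.cong refl)
          fix k assume k: "k \<in> {..<length p}"
          have k_eq: "k = length p - 1" if "\<not> Suc k < length p" using k that by auto
          have "(\<exists>x\<in>verts Q. drop k p = [x]) \<longleftrightarrow> k = length p - 1 \<and> last p \<in> verts Q"
            using k last_conv_nth[of p] by (cases "p = []"; cases "Suc k < length p")
              (auto simp: Cons_nth_drop_Suc[symmetric] less_Suc_eq k_eq)
          then show "(if \<exists>x\<in>verts Q. drop k p = [x] then 1 else 0) * f (take (k + 1) p) = (if k = length p - 1 then f p else 0)"
            using k inV[of p] last_in_set[of p] hd_in_set[of p] by (cases "p = []"; cases "set p \<subseteq> verts Q") (auto simp: subset_iff)
        qed
        then show "(\<one>\<^bsub>?R\<^esub> \<otimes>\<^bsub>?R\<^esub> f) p = f p" using f0 by (cases "p = []") auto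
      qed
      show "f \<otimes>\<^bsub>?R\<^esub> \<one>\<^bsub>?R\<^esub> = f"
      proof
        fix p
        have "(f \<otimes>\<^bsub>?R\<^esub> \<one>\<^bsub>?R\<^esub>) p = (\<Sum>k<length p. if k = 0 then f p else 0)"
          unfolding path_algebra_def monoid.simps ring.simps partial_object.simps
        proof (intro sum.cong refl)
          fix k assume k: "k \<in> {..<length p}"
          have "(\<exists>x\<in>verts Q. take (k + 1) p = [x]) \<longleftrightarrow> k = 0 \<and> hd p \<in> verts Q"
            using k by (cases p) (auto simp: take_Suc)
          then show "f (drop k p) * (if \<exists>x\<in>verts Q. take (k + 1) p = [x] then 1 else 0) = (if k = 0 then f p else 0)"
            using k inV[of p] last_in_set[of p] hd_in_set[of p] by (cases "p = []"; cases "set p \<subseteq> verts Q") (auto simp: subset_iff)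
        qed
        then show "(f \<otimes>\<^bsub>?R\<^esub> \<one>\<^bsub>?R\<^esub>) p = f p" using f0 by (cases "p = []") auto
      qed
    qed (simp_all add: path_algebra_mult_closed path_algebra_mult_assoc onec)
  qed (auto simp: path_algebra_def algebra_simps sum.distrib)
qed

definition arrow_ideal :: "nak_quiver \<Rightarrow> (nat list \<Rightarrow> 'k::field) set" where
  "arrow_ideal Q = Idl\<^bsub>path_algebra Q\<^esub> {path_elem [i, j] |i j. (i, j) \<in> arrows Q}"

text \<open>The power is taken in the monoid of ideals with the product of ideals. Finite-dimensionality of
  \<open>KQ/I\<close> is part of admissibility, through \<open>J\<^sup>m \<subseteq> I\<close>.\<close>

definition admissible :: "nak_quiver \<Rightarrow> (nat list \<Rightarrow> 'k::field) set \<Rightarrow> bool" where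
  "admissible Q I \<longleftrightarrow> ideal I (path_algebra Q) \<and>
    I \<subseteq> arrow_ideal Q [^]\<^bsub>ideals_set (path_algebra Q)\<^esub> (2::nat) \<and>
    (\<exists>m::nat\<ge>2. arrow_ideal Q [^]\<^bsub>ideals_set (path_algebra Q)\<^esub> m \<subseteq> I)"

definition minimal_generating_paths ::
  "nak_quiver \<Rightarrow> (nat list \<Rightarrow> 'k::field) set \<Rightarrow> nat list set \<Rightarrow> bool" where
  "minimal_generating_paths Q I G \<longleftrightarrow> finite G \<and> G \<subseteq> paths Q \<and>
    I = Idl\<^bsub>path_algebra Q\<^esub> (path_elem ` G) \<and>
    (\<forall>G'. G' \<subset> G \<longrightarrow> I \<noteq> Idl\<^bsub>path_algebra Q\<^esub> (path_elem ` G'))"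

abbreviation quot_algebra ::
  "nak_quiver \<Rightarrow> (nat list \<Rightarrow> 'k::field) set \<Rightarrow> (nat list \<Rightarrow> 'k) set ring" where
  "quot_algebra Q I \<equiv> path_algebra Q Quot I"

abbreviation cls ::
  "nak_quiver \<Rightarrow> (nat list \<Rightarrow> 'k::field) set \<Rightarrow> (nat list \<Rightarrow> 'k) \<Rightarrow> (nat list \<Rightarrow> 'k) set" where
  "cls Q I f \<equiv> I +>\<^bsub>path_algebra Q\<^esub> f"

definition scalar :: "nak_quiver \<Rightarrow> (nat list \<Rightarrow> 'k::field) set \<Rightarrow> 'k \<Rightarrow> (nat list \<Rightarrow> 'k) set" where
  "scalar Q I c = cls Q I (\<lambda>p. c * \<one>\<^bsub>path_algebra Q\<^esub> p)"


section \<open>Left modules over a not necessarily commutative ring\<close>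

text \<open>The locale \<open>module\<close> of the library assumes a commutative ring, but its record type and the
  locale \<open>submodule\<close> do not. The ring operations \<open>mult\<close> and \<open>one\<close> of the module record are unused.\<close>

definition quot_module :: "('a, 'b, 'c) module_scheme \<Rightarrow> 'b set \<Rightarrow> ('a, 'b set) module" where
  "quot_module M N =
    \<lparr>carrier = a_rcosets\<^bsub>M\<^esub> N, monoid.mult = undefined, one = undefined, zero = N, add = set_add M,
     module.smult = (\<lambda>a C. \<Union>m\<in>C. N +>\<^bsub>M\<^esub> (a \<odot>\<^bsub>M\<^esub> m))\<rparr>"

definition module_hom ::
  "('a, 'r) ring_scheme \<Rightarrow> ('a, 'b, 's) module_scheme \<Rightarrow> ('a, 'c, 't) module_scheme \<Rightarrow> ('b \<Rightarrow> 'c) set"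
  where
  "module_hom R M N = {f \<in> carrier M \<rightarrow> carrier N.
    (\<forall>x\<in>carrier M. \<forall>y\<in>carrier M. f (x \<oplus>\<^bsub>M\<^esub> y) = f x \<oplus>\<^bsub>N\<^esub> f y) \<and>
    (\<forall>a\<in>carrier R. \<forall>x\<in>carrier M. f (a \<odot>\<^bsub>M\<^esub> x) = a \<odot>\<^bsub>N\<^esub> f x)}"

definition module_iso ::
  "('a, 'r) ring_scheme \<Rightarrow> ('a, 'b, 's) module_scheme \<Rightarrow> ('a, 'c, 't) module_scheme \<Rightarrow> bool" where
  "module_iso R M N \<longleftrightarrow> (\<exists>f\<in>module_hom R M N. bij_betw f (carrier M) (carrier N))"

definition End_ring ::
  "('a, 'r) ring_scheme \<Rightarrow> ('a, 'b, 's) module_scheme \<Rightarrow> ('b \<Rightarrow> 'b) ring" where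
  "End_ring R M =
    \<lparr>carrier = module_hom R M M \<inter> extensional (carrier M),
     monoid.mult = (\<lambda>f g. compose (carrier M) f g),
     one = (\<lambda>x\<in>carrier M. x),
     zero = (\<lambda>x\<in>carrier M. \<zero>\<^bsub>M\<^esub>),
     add = (\<lambda>f g. \<lambda>x\<in>carrier M. f x \<oplus>\<^bsub>M\<^esub> g x)\<rparr>"

definition simple_module :: "('a, 'r) ring_scheme \<Rightarrow> ('a, 'b, 's) module_scheme \<Rightarrow> bool" where
  "simple_module R M \<longleftrightarrow> carrier M \<noteq> {\<zero>\<^bsub>M\<^esub>} \<and>
    (\<forall>N. submodule N R M \<longrightarrow> N = {\<zero>\<^bsub>M\<^esub>} \<or> N = carrier M)"

definition filtration ::
  "('a, 'r) ring_scheme \<Rightarrow> ('a, 'b, 's) module_scheme \<Rightarrow> nat \<Rightarrow> (nat \<Rightarrow> 'b set) \<Rightarrow> bool" where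
  "filtration R M t F \<longleftrightarrow> F 0 = {\<zero>\<^bsub>M\<^esub>} \<and> F t = carrier M \<and>
    (\<forall>i\<le>t. submodule (F i) R M) \<and> (\<forall>i<t. F i \<subseteq> F (Suc i))"

definition layer :: "('a, 'b) module \<Rightarrow> (nat \<Rightarrow> 'b set) \<Rightarrow> nat \<Rightarrow> ('a, 'b set) module" where
  "layer M F i = quot_module (M\<lparr>carrier := F (Suc i)\<rparr>) (F i)"

definition composition_series ::
  "('a, 'r) ring_scheme \<Rightarrow> ('a, 'b) module \<Rightarrow> nat \<Rightarrow> (nat \<Rightarrow> 'b set) \<Rightarrow> bool" where
  "composition_series R M t F \<longleftrightarrow> filtration R M t F \<and> (\<forall>i<t. simple_module R (layer M F i))"


section \<open>Quasi-hereditary orderings\<close>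

definition proj_module ::
  "nak_quiver \<Rightarrow> (nat list \<Rightarrow> 'k::field) set \<Rightarrow> nat \<Rightarrow> ((nat list \<Rightarrow> 'k) set, (nat list \<Rightarrow> 'k) set) module"
  where
  "proj_module Q I x =
    \<lparr>carrier = {a \<otimes>\<^bsub>quot_algebra Q I\<^esub> cls Q I (path_elem [x]) |a. a \<in> carrier (quot_algebra Q I)},
     monoid.mult = undefined, one = undefined,
     zero = \<zero>\<^bsub>quot_algebra Q I\<^esub>, add = add (quot_algebra Q I),
     module.smult = monoid.mult (quot_algebra Q I)\<rparr>"

text \<open>The simple module at \<open>x\<close> is \<open>P(x)/rad P(x)\<close>, where \<open>rad P(x) = (J/I) e\<^sub>x\<close> for the arrow ideal \<open>J\<close>.\<close>

definition simple_at ::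
  "nak_quiver \<Rightarrow> (nat list \<Rightarrow> 'k::field) set \<Rightarrow> nat \<Rightarrow> ((nat list \<Rightarrow> 'k) set, (nat list \<Rightarrow> 'k) set set) module"
  where
  "simple_at Q I x = quot_module (proj_module Q I x)
    {cls Q I j \<otimes>\<^bsub>quot_algebra Q I\<^esub> cls Q I (path_elem [x]) |j. j \<in> arrow_ideal Q}"

definition composition_factor ::
  "nak_quiver \<Rightarrow> (nat list \<Rightarrow> 'k::field) set \<Rightarrow> ((nat list \<Rightarrow> 'k) set, 'b) module \<Rightarrow> nat \<Rightarrow> bool" where
  "composition_factor Q I M y \<longleftrightarrow> y \<in> verts Q \<and>
    (\<exists>t F. composition_series (quot_algebra Q I) M t F \<and>
      (\<exists>i<t. module_iso (quot_algebra Q I) (layer M F i) (simple_at Q I y)))"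

text \<open>Factor modules of \<open>P(x)\<close> are given by their kernels, so the maximal one has the least kernel.\<close>

definition weyl_kernel ::
  "nak_quiver \<Rightarrow> (nat list \<Rightarrow> 'k::field) set \<Rightarrow> (nat \<times> nat) set \<Rightarrow> nat \<Rightarrow> (nat list \<Rightarrow> 'k) set set" where
  "weyl_kernel Q I r x =
    (let \<N> = {N. submodule N (quot_algebra Q I) (proj_module Q I x) \<and>
                (\<forall>y. composition_factor Q I (quot_module (proj_module Q I x) N) y \<longrightarrow> (y, x) \<in> r)}
     in THE N. N \<in> \<N> \<and> (\<forall>N'\<in>\<N>. N \<subseteq> N'))"

definition weyl_module ::
  "nak_quiver \<Rightarrow> (nat list \<Rightarrow> 'k::field) set \<Rightarrow> (nat \<times> nat) set \<Rightarrow> nat \<Rightarrow>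
    ((nat list \<Rightarrow> 'k) set, (nat list \<Rightarrow> 'k) set set) module" where
  "weyl_module Q I r x = quot_module (proj_module Q I x) (weyl_kernel Q I r x)"

definition good_module ::
  "nak_quiver \<Rightarrow> (nat list \<Rightarrow> 'k::field) set \<Rightarrow> (nat \<times> nat) set \<Rightarrow>
    ((nat list \<Rightarrow> 'k) set, 'b) module \<Rightarrow> bool" where
  "good_module Q I r M \<longleftrightarrow> (\<exists>t F. filtration (quot_algebra Q I) M t F \<and>
    (\<forall>i<t. \<exists>x\<in>verts Q. module_iso (quot_algebra Q I) (layer M F i) (weyl_module Q I r x)))"

text \<open>\<open>End\<^sub>A(M) \<simeq> K\<close> as \<open>K\<close>-algebras, where \<open>c\<close> acts on an endomorphism \<open>f\<close> by \<open>(c f)(m) = c f(m)\<close>.\<close>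

definition End_iso_field ::
  "nak_quiver \<Rightarrow> (nat list \<Rightarrow> 'k::field) set \<Rightarrow> ((nat list \<Rightarrow> 'k) set, 'b) module \<Rightarrow> bool" where
  "End_iso_field Q I M \<longleftrightarrow>
    (\<exists>\<phi> \<in> ring_iso (End_ring (quot_algebra Q I) M) (ring_of_type_algebra :: 'k ring).
      \<forall>c. \<forall>f\<in>carrier (End_ring (quot_algebra Q I) M).
        \<phi> (\<lambda>m\<in>carrier M. scalar Q I c \<odot>\<^bsub>M\<^esub> f m) = c * \<phi> f)"

definition q_ordering ::
  "nak_quiver \<Rightarrow> (nat list \<Rightarrow> 'k::field) set \<Rightarrow> (nat \<times> nat) set \<Rightarrow> bool" where
  "q_ordering Q I r \<longleftrightarrow> (\<forall>x\<in>verts Q.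
    End_iso_field Q I (weyl_module Q I r x) \<and> good_module Q I r (proj_module Q I x))"

end

theory Submission
  imports Defs "HOL-Library.Sublist"
begin

text \<open>
  All modules that occur are uniserial subquotients of the \<open>P(x)\<close>, and such a module is determined
  by its top \<open>z\<close> and its length \<open>w\<close>. The Weyl module at \<open>x\<close> has top \<open>x\<close> and reaches up to
  the first vertex \<open>y\<close> after \<open>x\<close> with \<open>y \<succ> x\<close>, or to the socle of \<open>P(x)\<close>. Its endomorphism ring is
  \<open>K\<close> iff \<open>x\<close> does not recur in it. A filtration of \<open>P(x)\<close> by Weyl modules is forced from the top:
  the tops of its layers are the successive records of the walk from \<open>x\<close>, so it exists iff the Weyl
  module at the last record does not reach beyond the socle of \<open>P(x)\<close>. A relation whose maximum is
  interior obstructs one of the two conditions, and conversely a failure of either condition exhibits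
  such a relation, namely the one that ends where \<open>P(x)\<close> is cut off.
\<close>

section \<open>Paths\<close>

text \<open>In the cyclic case a walk may meet a vertex several times, so the bookkeeping is done
  with positions on the walk from \<open>x\<close> instead of vertices. The obstacle is that the
  Weyl module at a record \<open>y = walk Q x s\<close> is cut out of \<open>P(y)\<close>, whereas
  the filtration needs it inside \<open>P(x)\<close>. With \<open>L\<close> the length of a
  projective, one has only \<open>L x \<le> s + L y\<close>, so \<open>P(y)\<close> can go on below
  the socle of \<open>P(x)\<close>. In the linear case \<open>P(x)\<close> may also end because the
  quiver ends, without any relation. This is excluded when a Weyl module is too long: position
  \<open>L x\<close> is then dominated by \<open>y\<close>, hence still a vertex, so a relation must
  end there. Finally, a generator starting in \<open>x\<close> has \<open>L x\<close> arrows and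
  visits one vertex more than \<open>P(x)\<close> has composition factors; dominance therefore has
  to be followed up to and including position \<open>L x\<close>.\<close>

definition nxt :: "nak_quiver \<Rightarrow> nat \<Rightarrow> nat" where
  "nxt Q x = (case Q of LinearA n \<Rightarrow> Suc x | CyclicA n \<Rightarrow> if x = n then 1 else Suc x)"

definition walk :: "nak_quiver \<Rightarrow> nat \<Rightarrow> nat \<Rightarrow> nat" where
  "walk Q x k = (nxt Q ^^ k) x"

text \<open>A path is determined by its start and its number of arrows \<open>k\<close>. On a linear
  quiver walks run past the last vertex, so membership in \<open>paths Q\<close> remains a separate
  condition.\<close>

definition pth :: "nak_quiver \<Rightarrow> nat \<Rightarrow> nat \<Rightarrow> nat list" where
  "pth Q x k = map (walk Q x) [0..<Suc k]"

lemma walk_0 [simp]: "walk Q x 0 = x"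
  by (simp add: walk_def)

lemma walk_Suc: "walk Q x (Suc k) = nxt Q (walk Q x k)"
  by (simp add: walk_def)

lemma walk_walk [simp]: "walk Q (walk Q x j) k = walk Q x (j + k)"
  by (simp add: walk_def add.commute[of j] funpow_add)

lemma length_pth [simp]: "length (pth Q x k) = Suc k"
  by (simp add: pth_def)

lemma pth_not_Nil [simp]: "pth Q x k \<noteq> []"
  by (simp add: pth_def)

lemma nth_pth: "j \<le> k \<Longrightarrow> pth Q x k ! j = walk Q x j"
  unfolding pth_def by (subst nth_map) (auto simp del: upt_Suc)

lemma hd_pth [simp]: "hd (pth Q x k) = x"
  by (simp add: hd_conv_nth nth_pth)

lemma last_pth [simp]: "last (pth Q x k) = walk Q x k"
  by (simp add: last_conv_nth nth_pth)

lemma pth_0 [simp]: "pth Q x 0 = [x]"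
  by (simp add: pth_def)

lemma pth_Suc: "pth Q x (Suc k) = pth Q x k @ [walk Q x (Suc k)]"
  by (simp add: pth_def)

lemma set_pth: "set (pth Q x k) = walk Q x ` {..k}"
  by (auto simp add: pth_def simp del: upt_Suc)

lemma drop_pth [simp]: "l \<le> k \<Longrightarrow> drop l (pth Q x k) = pth Q (walk Q x l) (k - l)"
  by (rule nth_equalityI) (auto simp: nth_pth)

lemma take_pth [simp]: "l \<le> k \<Longrightarrow> take (Suc l) (pth Q x k) = pth Q x l"
  by (rule nth_equalityI) (auto simp: nth_pth)

lemma pth_append: "pth Q x l @ tl (pth Q (walk Q x l) m) = pth Q x (l + m)"
proof (rule nth_equalityI)
  fix i assume "i < length (pth Q x l @ tl (pth Q (walk Q x l) m))"
  then show "(pth Q x l @ tl (pth Q (walk Q x l) m)) ! i = pth Q x (l + m) ! i"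
    by (cases "i \<le> l") (auto simp: nth_append nth_tl nth_pth)
qed simp

lemma pth_eq_iff [simp]: "pth Q x k = pth Q y l \<longleftrightarrow> x = y \<and> k = l"
  by (metis hd_pth length_pth nat.inject)

text \<open>Divisibility of paths becomes an inequality between positions, because a contiguous
  piece of a walk is determined by where it starts and how many arrows it has.\<close>

lemma sublist_pth_iff: "sublist (pth Q y l) (pth Q x k) \<longleftrightarrow> (\<exists>j. j + l \<le> k \<and> walk Q x j = y)"
proof
  assume "sublist (pth Q y l) (pth Q x k)"
  then obtain ps ss where p: "pth Q x k = ps @ pth Q y l @ ss" by (auto simp: sublist_def)
  have len: "length ps + l \<le> k"
  proof -
    have "length (pth Q x k) = length (ps @ pth Q y l @ ss)" by (simp only: p)
    then show ?thesis by simp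
  qed
  have "pth Q x k ! length ps = pth Q y l ! 0"
    by (simp add: p nth_append)
  then show "\<exists>j. j + l \<le> k \<and> walk Q x j = y"
    using len by (auto simp: nth_pth)
next
  assume "\<exists>j. j + l \<le> k \<and> walk Q x j = y"
  then obtain j where j: "j + l \<le> k" "walk Q x j = y" by blast
  then have "take (Suc l) (drop j (pth Q x k)) = pth Q y l" by simp
  then show "sublist (pth Q y l) (pth Q x k)"
    by (metis sublist_drop sublist_order.order.trans sublist_take)
qed

text \<open>Only one occurrence of each end is removed, so an end vertex that the path meets again
  in between stays in the interior.\<close>

lemma Interior_pth: "y \<in># Interior (pth Q x l) \<longleftrightarrow> (\<exists>j. 0 < j \<and> j < l \<and> walk Q x j = y)"
proof (cases l)
  case 0
  then show ?thesis by (simp add: Interior_def Hod_def)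
next
  case (Suc m)
  have e: "[0..<Suc l] = 0 # [1..<Suc m] @ [Suc m]"
    unfolding Suc by (metis One_nat_def le0 upt_Suc_append upt_conv_Cons zero_less_Suc le_SucI Suc_le_mono append_Cons)
  have "pth Q x l = x # map (walk Q x) [1..<Suc m] @ [walk Q x (Suc m)]"
    unfolding pth_def e by simp
  then have "Interior (pth Q x l) = mset (map (walk Q x) [1..<Suc m])"
    unfolding Interior_def Hod_def by (simp add: Suc del: upt_Suc)
  then show ?thesis by (auto simp: Suc Suc_le_eq simp del: upt_Suc)
qed

locale quiver =
  fixes Q :: nak_quiver and n :: nat
  assumes n: "n \<ge> 1" and Q: "Q = LinearA n \<or> Q = CyclicA n"
begin

lemma arrows_iff: "(i, j) \<in> arrows Q \<longleftrightarrow> i \<in> verts Q \<and> j \<in> verts Q \<and> j = nxt Q i"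
  using n Q by (auto simp: nxt_def)

text \<open>A walk that has left the linear quiver never comes back, and the cyclic quiver is never
  left. So only the two ends of a path need checking.\<close>

lemma walk_verts_le: "walk Q x k \<in> verts Q \<Longrightarrow> x \<in> verts Q \<Longrightarrow> j \<le> k \<Longrightarrow> walk Q x j \<in> verts Q"
proof (induction k)
  case (Suc k)
  have "walk Q x k \<ge> 1" if "x \<ge> 1" for k
    using that Q by (induction k) (auto simp: walk_Suc nxt_def)
  then have "walk Q x k \<in> verts Q"
    using Suc.prems n Q by (fastforce simp: walk_Suc nxt_def split: if_splits)
  then show ?case using Suc by (cases "j = Suc k") auto
qed simp

lemma pth_in_paths_iff: "pth Q x k \<in> paths Q \<longleftrightarrow> x \<in> verts Q \<and> walk Q x k \<in> verts Q"
proof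
  assume "pth Q x k \<in> paths Q"
  then show "x \<in> verts Q \<and> walk Q x k \<in> verts Q"
    by (force simp: paths_def set_pth simp del: pth_eq_iff)
next
  assume *: "x \<in> verts Q \<and> walk Q x k \<in> verts Q"
  then have v: "walk Q x j \<in> verts Q" if "j \<le> k" for j using that walk_verts_le by blast
  have "successively (\<lambda>i j. (i, j) \<in> arrows Q) (pth Q x k)"
    using v by (auto simp: successively_conv_nth nth_pth arrows_iff walk_Suc[symmetric])
  then show "pth Q x k \<in> paths Q" using v by (auto simp: paths_def set_pth)
qed

lemma pathsE:
  assumes "p \<in> paths Q"
  obtains k where "p = pth Q (hd p) k" "k = length p - 1"
proof
  have "p ! j = walk Q (hd p) j" if "j < length p" for j
    using that
  proof (induction j)
    case 0
    then show ?case by (simp add: hd_conv_nth)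
  next
    case (Suc j)
    then have "(p ! j, p ! Suc j) \<in> arrows Q"
      using assms by (auto simp: paths_def successively_conv_nth)
    then show ?case using Suc by (simp add: arrows_iff walk_Suc)
  qed
  then show "p = pth Q (hd p) (length p - 1)"
    using assms by (intro nth_equalityI) (auto simp: nth_pth paths_def)
qed simp

lemma pth_paths_le: "pth Q x k \<in> paths Q \<Longrightarrow> j \<le> k \<Longrightarrow> pth Q x j \<in> paths Q"
  using walk_verts_le by (auto simp: pth_in_paths_iff)

lemma pth_walk_paths: "pth Q x k \<in> paths Q \<Longrightarrow> j \<le> k \<Longrightarrow> pth Q (walk Q x j) (k - j) \<in> paths Q"
  using walk_verts_le by (auto simp: pth_in_paths_iff)

end

section \<open>The path algebra in coordinates\<close>

lemma mem_path_algebra: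
  "f \<in> carrier (path_algebra Q) \<longleftrightarrow> finite {p. f p \<noteq> 0} \<and> (\<forall>p. f p \<noteq> 0 \<longrightarrow> p \<in> paths Q)"
  by (auto simp: path_algebra_def)

lemma path_algebra_eq_0: "f \<in> carrier (path_algebra Q) \<Longrightarrow> p \<notin> paths Q \<Longrightarrow> f p = 0"
  by (auto simp: mem_path_algebra)

lemma add_apply: "(f \<oplus>\<^bsub>path_algebra Q\<^esub> g) p = f p + g p"
  by (simp add: path_algebra_def)

lemma zero_apply: "\<zero>\<^bsub>path_algebra Q\<^esub> p = 0"
  by (simp add: path_algebra_def)

lemma one_pth_apply:
  "\<one>\<^bsub>path_algebra Q\<^esub> (pth Q x k) = (if k = 0 \<and> x \<in> verts Q then 1 else 0)"
  by (cases k) (auto simp: path_algebra_def pth_Suc)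

text \<open>The product at a path from \<open>x\<close> uses \<open>g\<close> only at initial
  segments of that path. This triangularity makes \<open>vanish\<close> stable under left
  multiplication and makes agreement of the first coefficients a congruence.\<close>

lemma mult_pth_apply:
  "(f \<otimes>\<^bsub>path_algebra Q\<^esub> g) (pth Q x k) =
    (\<Sum>l\<le>k. f (pth Q (walk Q x l) (k - l)) * g (pth Q x l))"
  unfolding path_algebra_def by (auto simp: less_Suc_eq_le lessThan_Suc_atMost intro!: sum.cong)

lemma mult_l_distr: "(f \<oplus>\<^bsub>path_algebra Q\<^esub> g) \<otimes>\<^bsub>path_algebra Q\<^esub> h =
    (f \<otimes>\<^bsub>path_algebra Q\<^esub> h) \<oplus>\<^bsub>path_algebra Q\<^esub> (g \<otimes>\<^bsub>path_algebra Q\<^esub> h)"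
  by (simp add: path_algebra_def algebra_simps sum.distrib)

lemma path_elem_mult_pth_apply:
  "(path_elem (pth Q y m) \<otimes>\<^bsub>path_algebra Q\<^esub> f) (pth Q z k) =
    (if m \<le> k \<and> walk Q z (k - m) = y then f (pth Q z (k - m)) else 0)"
proof -
  have "(path_elem (pth Q y m) \<otimes>\<^bsub>path_algebra Q\<^esub> f) (pth Q z k) =
      (\<Sum>l\<le>k. if l = k - m then if m \<le> k \<and> walk Q z (k - m) = y then f (pth Q z (k - m)) else 0 else 0)"
    unfolding mult_pth_apply by (intro sum.cong refl) (auto simp: path_elem_def)
  then show ?thesis by simp
qed

lemma mult_path_elem_pth_apply:
  "(f \<otimes>\<^bsub>path_algebra Q\<^esub> path_elem (pth Q y m)) (pth Q z k) =
    (if z = y \<and> m \<le> k then f (pth Q (walk Q y m) (k - m)) else 0)"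
proof -
  have "(f \<otimes>\<^bsub>path_algebra Q\<^esub> path_elem (pth Q y m)) (pth Q z k) =
      (\<Sum>l\<le>k. if l = m then if z = y then f (pth Q (walk Q y m) (k - m)) else 0 else 0)"
    unfolding mult_pth_apply by (intro sum.cong refl) (auto simp: path_elem_def)
  then show ?thesis by simp
qed

lemma path_elem_closed: "p \<in> paths Q \<Longrightarrow> path_elem p \<in> carrier (path_algebra Q)"
  by (simp add: mem_path_algebra path_elem_def)

lemma scale_closed:
  "f \<in> carrier (path_algebra Q) \<Longrightarrow> (\<lambda>p. c * f p) \<in> carrier (path_algebra Q)"
  unfolding mem_path_algebra by (auto elim: rev_finite_subset)

lemma scale_mult: "(\<lambda>p. c * f p) \<otimes>\<^bsub>path_algebra Q\<^esub> g = (\<lambda>p. c * (f \<otimes>\<^bsub>path_algebra Q\<^esub> g) p)"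
  by (simp add: path_algebra_def sum_distrib_left mult.assoc)

lemma mult_scale: "f \<otimes>\<^bsub>path_algebra Q\<^esub> (\<lambda>p. c * g p) = (\<lambda>p. c * (f \<otimes>\<^bsub>path_algebra Q\<^esub> g) p)"
  by (simp add: path_algebra_def sum_distrib_left mult.left_commute)

lemma zero_closed: "\<zero>\<^bsub>path_algebra Q\<^esub> \<in> carrier (path_algebra Q)"
  and one_closed: "\<one>\<^bsub>path_algebra Q\<^esub> \<in> carrier (path_algebra Q)"
  and add_closed: "f \<in> carrier (path_algebra Q) \<Longrightarrow> g \<in> carrier (path_algebra Q) \<Longrightarrow>
    f \<oplus>\<^bsub>path_algebra Q\<^esub> g \<in> carrier (path_algebra Q)"
  for f g :: "nat list \<Rightarrow> 'k::field"
  by (rule ring.ring_simprules[OF path_algebra_ring])+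

lemmas path_algebra_closed =
  zero_closed one_closed add_closed scale_closed path_algebra_mult_closed

context quiver
begin

text \<open>Even if \<open>pth Q z i\<close> leaves the quiver, the product is the zero function.\<close>

lemma mult_path_elem_closed:
  assumes f: "f \<in> carrier (path_algebra Q)" and z: "i = 0 \<or> z \<in> verts Q"
  shows "f \<otimes>\<^bsub>path_algebra Q\<^esub> path_elem (pth Q z i) \<in> carrier (path_algebra Q)"
proof (cases "pth Q z i \<in> paths Q")
  case True
  then show ?thesis by (simp add: f path_algebra_mult_closed path_elem_closed)
next
  case False
  have "(f \<otimes>\<^bsub>path_algebra Q\<^esub> path_elem (pth Q z i)) p = 0" for p
  proof (rule ccontr)
    assume "(f \<otimes>\<^bsub>path_algebra Q\<^esub> path_elem (pth Q z i)) p \<noteq> 0"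
    then obtain k where k: "k < length p" "f (drop k p) \<noteq> 0" "take (k + 1) p = pth Q z i"
      by (auto simp: path_algebra_def path_elem_def elim!: sum.not_neutral_contains_not_neutral split: if_splits)
    have "hd (drop k p) = last (take (k + 1) p)"
      using k(1) by (simp add: hd_drop_conv_nth take_Suc_conv_app_nth)
    then have "hd (drop k p) = walk Q z i" unfolding k(3) by simp
    moreover have "drop k p \<in> paths Q" using f k by (auto simp: mem_path_algebra)
    then have "hd (drop k p) \<in> verts Q" by (auto simp: paths_def)
    ultimately show False using False z by (auto simp: pth_in_paths_iff)
  qed
  then have "f \<otimes>\<^bsub>path_algebra Q\<^esub> path_elem (pth Q z i) = \<zero>\<^bsub>path_algebra Q\<^esub>"
    by (auto simp: path_algebra_def)
  then show ?thesis by (simp add: zero_closed)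
qed

text \<open>In a uniserial module with top \<open>z\<close>, the image of this set is the
  \<open>i\<close>-th radical power, for \<open>i\<close> up to the length.\<close>

definition vanish :: "nat \<Rightarrow> nat \<Rightarrow> (nat list \<Rightarrow> 'k::field) set" where
  "vanish z i = {f \<in> carrier (path_algebra Q). \<forall>k<i. f (pth Q z k) = 0}"

end

locale nakayama = quiver +
  fixes I :: "(nat list \<Rightarrow> 'k::field) set"
  assumes ideal_I: "ideal I (path_algebra Q)"
begin

abbreviation "KQ \<equiv> path_algebra Q :: (nat list \<Rightarrow> 'k) ring"
abbreviation "A \<equiv> quot_algebra Q I"

sublocale I: ideal I KQ
  by (rule ideal_I)

lemma carrier_A: "carrier A = cls Q I ` carrier KQ"
  by (auto simp: FactRing_def A_RCOSETS_def RCOSETS_def a_r_coset_def)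

lemma cls_mult: "f \<in> carrier KQ \<Longrightarrow> g \<in> carrier KQ \<Longrightarrow>
    cls Q I f \<otimes>\<^bsub>A\<^esub> cls Q I g = cls Q I (f \<otimes>\<^bsub>KQ\<^esub> g)"
  using I.rcos_ring_hom by (simp add: ring_hom_def)

lemma cls_add: "f \<in> carrier KQ \<Longrightarrow> g \<in> carrier KQ \<Longrightarrow>
    cls Q I f \<oplus>\<^bsub>A\<^esub> cls Q I g = cls Q I (f \<oplus>\<^bsub>KQ\<^esub> g)"
  using I.rcos_ring_hom by (simp add: ring_hom_def)

section \<open>Uniserial modules\<close>

text \<open>\<open>uniserial M z w \<Phi>\<close>: \<open>M\<close> is uniserial with composition factors \<open>z, z + 1, \<dots>, z + w - 1\<close> from top to
  socle. The map \<open>\<Phi>\<close> sends \<open>f \<in> KQ\<close> to \<open>f m\<close> for a generator \<open>m\<close>; it identifies \<open>M\<close> with the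
  vectors of coefficients of \<open>f\<close> at the \<open>w\<close> shortest paths starting in \<open>z\<close>.\<close>

definition uniserial :: "((nat list \<Rightarrow> 'k) set, 'b) module \<Rightarrow> nat \<Rightarrow> nat \<Rightarrow> ((nat list \<Rightarrow> 'k) \<Rightarrow> 'b) \<Rightarrow> bool"
  where "uniserial M z w \<Phi> \<longleftrightarrow> (\<forall>k<w. pth Q z k \<in> paths Q) \<and> carrier M = \<Phi> ` carrier KQ \<and>
    \<zero>\<^bsub>M\<^esub> = \<Phi> \<zero>\<^bsub>KQ\<^esub> \<and>
    (\<forall>f\<in>carrier KQ. \<forall>g\<in>carrier KQ. \<Phi> f \<oplus>\<^bsub>M\<^esub> \<Phi> g = \<Phi> (f \<oplus>\<^bsub>KQ\<^esub> g)) \<and>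
    (\<forall>f\<in>carrier KQ. \<forall>g\<in>carrier KQ. cls Q I f \<odot>\<^bsub>M\<^esub> \<Phi> g = \<Phi> (f \<otimes>\<^bsub>KQ\<^esub> g)) \<and>
    (\<forall>f\<in>carrier KQ. \<forall>g\<in>carrier KQ. \<Phi> f = \<Phi> g \<longleftrightarrow> (\<forall>k<w. f (pth Q z k) = g (pth Q z k)))"

lemma uniserialI:
  assumes "\<And>k. k < w \<Longrightarrow> pth Q z k \<in> paths Q" "carrier M = \<Phi> ` carrier KQ" "\<zero>\<^bsub>M\<^esub> = \<Phi> \<zero>\<^bsub>KQ\<^esub>"
    and "\<And>f g. f \<in> carrier KQ \<Longrightarrow> g \<in> carrier KQ \<Longrightarrow> \<Phi> f \<oplus>\<^bsub>M\<^esub> \<Phi> g = \<Phi> (f \<oplus>\<^bsub>KQ\<^esub> g)"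
    and "\<And>f g. f \<in> carrier KQ \<Longrightarrow> g \<in> carrier KQ \<Longrightarrow> cls Q I f \<odot>\<^bsub>M\<^esub> \<Phi> g = \<Phi> (f \<otimes>\<^bsub>KQ\<^esub> g)"
    and "\<And>f g. f \<in> carrier KQ \<Longrightarrow> g \<in> carrier KQ \<Longrightarrow>
      \<Phi> f = \<Phi> g \<longleftrightarrow> (\<forall>k<w. f (pth Q z k) = g (pth Q z k))"
  shows "uniserial M z w \<Phi>"
  unfolding uniserial_def by (intro conjI ballI allI impI) (rule assms; assumption)+

context
  fixes M :: "((nat list \<Rightarrow> 'k) set, 'b) module" and z w \<Phi>
  assumes uniserial: "uniserial M z w \<Phi>"
begin

lemma uniserial_paths: "k < w \<Longrightarrow> pth Q z k \<in> paths Q"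
  and uniserial_carrier: "carrier M = \<Phi> ` carrier KQ"
  and uniserial_zero: "\<zero>\<^bsub>M\<^esub> = \<Phi> \<zero>\<^bsub>KQ\<^esub>"
  and uniserial_add: "f \<in> carrier KQ \<Longrightarrow> g \<in> carrier KQ \<Longrightarrow> \<Phi> f \<oplus>\<^bsub>M\<^esub> \<Phi> g = \<Phi> (f \<oplus>\<^bsub>KQ\<^esub> g)"
  and uniserial_smult: "f \<in> carrier KQ \<Longrightarrow> g \<in> carrier KQ \<Longrightarrow> cls Q I f \<odot>\<^bsub>M\<^esub> \<Phi> g = \<Phi> (f \<otimes>\<^bsub>KQ\<^esub> g)"
  and uniserial_eq_iff: "f \<in> carrier KQ \<Longrightarrow> g \<in> carrier KQ \<Longrightarrow>
    \<Phi> f = \<Phi> g \<longleftrightarrow> (\<forall>k<w. f (pth Q z k) = g (pth Q z k))"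
  using uniserial unfolding uniserial_def by simp_all

lemma uniserial_start: "i \<le> w \<Longrightarrow> i = 0 \<or> z \<in> verts Q"
  using uniserial_paths[of 0] by (auto simp: paths_def)

lemma uniserial_abelian_group: "abelian_group M"
proof (rule abelian_groupI)
  fix x assume "x \<in> carrier M"
  then obtain f where f: "f \<in> carrier KQ" "x = \<Phi> f" by (auto simp: uniserial_carrier)
  have "\<Phi> (\<lambda>p. -1 * f p) \<oplus>\<^bsub>M\<^esub> x = \<Phi> \<zero>\<^bsub>KQ\<^esub>"
    using f scale_closed[of f Q "-1"]
    by (simp only: uniserial_add) (subst uniserial_eq_iff, auto simp: path_algebra_closed add_apply zero_apply)
  then show "\<exists>y\<in>carrier M. y \<oplus>\<^bsub>M\<^esub> x = \<zero>\<^bsub>M\<^esub>"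
    using f scale_closed[of f Q "-1"] by (metis uniserial_zero uniserial_carrier image_eqI)
qed (auto simp: uniserial_carrier uniserial_zero uniserial_add path_algebra_closed uniserial_eq_iff add_apply zero_apply add_ac)

section \<open>The chain of submodules of a uniserial module\<close>

lemma uniserial_submodule:
  assumes "i \<le> w"
  shows "submodule (\<Phi> ` vanish z i) A M"
proof -
  interpret M: abelian_group M by (rule uniserial_abelian_group)
  have "subgroup (\<Phi> ` vanish z i) (add_monoid M)"
  proof
    fix x assume "x \<in> \<Phi> ` vanish z i"
    then obtain f where f: "f \<in> carrier KQ" "\<And>k. k < i \<Longrightarrow> f (pth Q z k) = 0" "x = \<Phi> f"
      by (auto simp: vanish_def)
    have g: "(\<lambda>p. -1 * f p) \<in> carrier KQ" by (rule scale_closed) (rule f)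
    have "\<Phi> (\<lambda>p. -1 * f p) \<oplus>\<^bsub>M\<^esub> x = \<zero>\<^bsub>M\<^esub>"
      unfolding uniserial_zero f(3) uniserial_add[OF g f(1)]
      by (subst uniserial_eq_iff) (use f g in \<open>auto simp: path_algebra_closed add_apply zero_apply\<close>)
    then have "inv\<^bsub>add_monoid M\<^esub> x = \<Phi> (\<lambda>p. -1 * f p)"
      using f g M.minus_equality by (simp add: a_inv_def uniserial_carrier)
    then show "inv\<^bsub>add_monoid M\<^esub> x \<in> \<Phi> ` vanish z i"
      using f g by (auto simp: vanish_def)
  next
    fix x y assume "x \<in> \<Phi> ` vanish z i" "y \<in> \<Phi> ` vanish z i"
    then show "x \<otimes>\<^bsub>add_monoid M\<^esub> y \<in> \<Phi> ` vanish z i"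
      by (auto simp: vanish_def uniserial_add path_algebra_closed add_apply)
  qed (auto simp: vanish_def uniserial_carrier uniserial_zero path_algebra_closed zero_apply)
  moreover have "a \<odot>\<^bsub>M\<^esub> x \<in> \<Phi> ` vanish z i" if "a \<in> carrier A" "x \<in> \<Phi> ` vanish z i" for a x
    using that by (auto simp: carrier_A vanish_def uniserial_smult path_algebra_closed mult_pth_apply)
  ultimately show ?thesis
    by (simp add: submodule_def submodule_axioms_def)
qed

lemma uniserial_vanish_mono: "i \<le> j \<Longrightarrow> \<Phi> ` vanish z j \<subseteq> \<Phi> ` vanish z i"
  by (auto simp: vanish_def)

lemma uniserial_vanish_zero: "\<Phi> ` vanish z w = {\<zero>\<^bsub>M\<^esub>}"
proof -
  have "\<Phi> f = \<Phi> \<zero>\<^bsub>KQ\<^esub>" if "f \<in> vanish z w" for f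
    using that by (subst uniserial_eq_iff) (auto simp: path_algebra_closed zero_apply vanish_def)
  moreover have "\<zero>\<^bsub>KQ\<^esub> \<in> vanish z w"
    by (auto simp: path_algebra_closed zero_apply vanish_def)
  ultimately show ?thesis unfolding uniserial_zero by blast
qed

lemma uniserial_vanish_all: "\<Phi> ` vanish z 0 = carrier M"
  by (simp add: vanish_def uniserial_carrier)

lemma uniserial_mem_iff:
  assumes "f \<in> carrier KQ" "i \<le> w"
  shows "\<Phi> f \<in> \<Phi> ` vanish z i \<longleftrightarrow> f \<in> vanish z i"
proof
  assume "\<Phi> f \<in> \<Phi> ` vanish z i"
  then obtain g where "g \<in> carrier KQ" "\<Phi> f = \<Phi> g" "\<forall>k<i. g (pth Q z k) = 0"
    by (auto simp: vanish_def)
  then show "f \<in> vanish z i" using assms by (simp add: vanish_def uniserial_eq_iff)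
qed auto

lemma uniserial_subset_iff:
  assumes "i \<le> w" "j \<le> w"
  shows "\<Phi> ` vanish z i \<subseteq> \<Phi> ` vanish z j \<longleftrightarrow> j \<le> i"
proof
  assume sub: "\<Phi> ` vanish z i \<subseteq> \<Phi> ` vanish z j"
  show "j \<le> i"
  proof (rule ccontr)
    assume "\<not> j \<le> i"
    then have p: "(path_elem (pth Q z i) :: _ \<Rightarrow> 'k) \<in> carrier KQ"
      using assms by (intro path_elem_closed uniserial_paths) auto
    then have "(path_elem (pth Q z i) :: _ \<Rightarrow> 'k) \<in> vanish z i"
      by (simp add: vanish_def) (simp add: path_elem_def)
    then have "\<Phi> (path_elem (pth Q z i)) \<in> \<Phi> ` vanish z j"
      using sub by (meson image_eqI subsetD)
    then have "path_elem (pth Q z i) \<in> (vanish z j :: (_ \<Rightarrow> 'k) set)"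
      by (simp only: uniserial_mem_iff[OF p assms(2)])
    then have "(path_elem (pth Q z i) (pth Q z i) :: 'k) = 0"
      unfolding vanish_def using \<open>\<not> j \<le> i\<close> by simp
    then show False by (simp add: path_elem_def)
  qed
qed (rule uniserial_vanish_mono)

text \<open>There is a single chain because an element with first nonzero coefficient at position
  \<open>i\<close> generates everything that vanishes before \<open>i\<close>: multiplication by
  paths moves its leading coefficient to any later position.\<close>

lemma uniserial_submodule_cases:
  assumes N: "submodule N A M"
  obtains i where "i \<le> w" "N = \<Phi> ` vanish z i"
proof -
  interpret N: submodule N A M by (rule N)
  have N_add: "x \<oplus>\<^bsub>M\<^esub> y \<in> N" if "x \<in> N" "y \<in> N" for x y
    using N.m_closed that by simp
  have N_zero: "\<zero>\<^bsub>M\<^esub> \<in> N" using N.one_closed by simp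
  \<comment> \<open>The alternative \<open>k = w\<close> makes the least position exist for the zero
    submodule too.\<close>
  define P where "P k \<longleftrightarrow> k = w \<or> (\<exists>f\<in>carrier KQ. \<Phi> f \<in> N \<and> f (pth Q z k) \<noteq> 0)" for k
  define i where "i = (LEAST k. P k)"
  have Pi: "P i" and i_le: "i \<le> w" and least: "\<And>k. k < i \<Longrightarrow> \<not> P k"
    unfolding i_def by (rule LeastI[of P w], simp add: P_def, rule Least_le, simp add: P_def)
      (rule not_less_Least)
  have sub: "N \<subseteq> \<Phi> ` vanish z i"
  proof
    fix x assume "x \<in> N"
    moreover then obtain f where "f \<in> carrier KQ" "x = \<Phi> f"
      using N.subset by (auto simp: uniserial_carrier)
    ultimately show "x \<in> \<Phi> ` vanish z i"
      using least by (auto simp: P_def vanish_def)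
  qed
  \<comment> \<open>The chain is climbed from the socle, one position at a time.\<close>
  have step: "\<Phi> ` vanish z (w - d) \<subseteq> N" if "d \<le> w - i" for d
    using that
  proof (induction d)
    case 0
    then show ?case by (simp add: uniserial_vanish_zero N_zero)
  next
    case (Suc d)
    define k where "k = w - Suc d"
    have k: "i \<le> k" "k < w" "w - d = Suc k" using Suc.prems by (auto simp: k_def)
    then have "i < w" by simp
    then obtain f where f: "f \<in> carrier KQ" "\<Phi> f \<in> N" "f (pth Q z i) \<noteq> 0"
      using Pi by (auto simp: P_def)
    have f0: "f (pth Q z l) = 0" if "l < i" for l
      using least[OF that] f by (auto simp: P_def)
    show ?case
    proof
      fix x assume "x \<in> \<Phi> ` vanish z (w - Suc d)"
      then obtain g where g: "g \<in> carrier KQ" "x = \<Phi> g" "\<And>l. l < k \<Longrightarrow> g (pth Q z l) = 0"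
        by (auto simp: vanish_def k_def)
      \<comment> \<open>This path moves position \<open>i\<close> to position \<open>k\<close>, and
        the scalar matches the coefficient of \<open>g\<close> there. Subtracting \<open>a\<close>
        times \<open>f\<close> from \<open>g\<close> therefore gains one more vanishing
        position.\<close>
      define a :: "nat list \<Rightarrow> 'k" where
        "a = (\<lambda>p. g (pth Q z k) / f (pth Q z i) * path_elem (pth Q (walk Q z i) (k - i)) p)"
      have "pth Q (walk Q z i) (k - i) \<in> paths Q"
        using uniserial_paths[OF k(2)] k(1) by (rule pth_walk_paths)
      then have a: "a \<in> carrier KQ" unfolding a_def by (intro scale_closed path_elem_closed)
      have h: "a \<otimes>\<^bsub>KQ\<^esub> f \<in> carrier KQ" using a f by (simp add: path_algebra_closed)
      have h': "(\<lambda>p. -1 * (a \<otimes>\<^bsub>KQ\<^esub> f) p) \<in> carrier KQ" by (rule scale_closed) (rule h)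
      have af: "(a \<otimes>\<^bsub>KQ\<^esub> f) (pth Q z l) = g (pth Q z l)" if "l \<le> k" for l
        using that k f(3) g(3)[of l] f0 unfolding a_def scale_mult path_elem_mult_pth_apply
        by (cases "l = k") auto
      have "\<Phi> (a \<otimes>\<^bsub>KQ\<^esub> f) \<in> N"
        using N.smult_closed[of "cls Q I a" "\<Phi> f"] a f by (simp add: uniserial_smult carrier_A)
      moreover have "g \<oplus>\<^bsub>KQ\<^esub> (\<lambda>p. -1 * (a \<otimes>\<^bsub>KQ\<^esub> f) p) \<in> vanish z (w - d)"
        using g(1) h' af by (auto simp: vanish_def path_algebra_closed add_apply k)
      then have "\<Phi> (g \<oplus>\<^bsub>KQ\<^esub> (\<lambda>p. -1 * (a \<otimes>\<^bsub>KQ\<^esub> f) p)) \<in> N"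
        using Suc by auto
      ultimately have "\<Phi> ((g \<oplus>\<^bsub>KQ\<^esub> (\<lambda>p. -1 * (a \<otimes>\<^bsub>KQ\<^esub> f) p)) \<oplus>\<^bsub>KQ\<^esub> (a \<otimes>\<^bsub>KQ\<^esub> f)) \<in> N"
        using N_add h h' g(1) by (simp add: uniserial_add[symmetric] add_closed)
      also have "\<Phi> ((g \<oplus>\<^bsub>KQ\<^esub> (\<lambda>p. -1 * (a \<otimes>\<^bsub>KQ\<^esub> f) p)) \<oplus>\<^bsub>KQ\<^esub> (a \<otimes>\<^bsub>KQ\<^esub> f)) = \<Phi> g"
        using g(1) h h' by (subst uniserial_eq_iff) (auto simp: add_closed add_apply)
      finally show "x \<in> N" using g by simp
    qed
  qed
  have "\<Phi> ` vanish z i \<subseteq> N" using step[of "w - i"] i_le by simp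
  then show thesis using that i_le sub by blast
qed

section \<open>Factors and submodules of uniserial modules\<close>

text \<open>The displayed map is the coset of \<open>\<Phi> f\<close>: two elements are congruent
  modulo the \<open>i\<close>-th radical power iff their first \<open>i\<close> coefficients
  agree.\<close>

lemma uniserial_quotient:
  assumes i: "i \<le> w"
  shows "uniserial (quot_module M (\<Phi> ` vanish z i)) z i
    (\<lambda>f. \<Phi> ` {g \<in> carrier KQ. \<forall>k<i. g (pth Q z k) = f (pth Q z k)})" (is "uniserial ?M z i ?\<Psi>")
proof -
  have coset: "\<Phi> ` vanish z i +>\<^bsub>M\<^esub> \<Phi> f = ?\<Psi> f" if f: "f \<in> carrier KQ" for f
  proof -
    have "\<Phi> ` vanish z i +>\<^bsub>M\<^esub> \<Phi> f = (\<lambda>h. \<Phi> (h \<oplus>\<^bsub>KQ\<^esub> f)) ` vanish z i"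
      using f by (auto simp: a_r_coset_def r_coset_def uniserial_add vanish_def)
    also have "\<dots> = ?\<Psi> f"
    proof (intro equalityI subsetI)
      fix x assume "x \<in> ?\<Psi> f"
      then obtain g where g: "g \<in> carrier KQ" "x = \<Phi> g" "\<And>k. k < i \<Longrightarrow> g (pth Q z k) = f (pth Q z k)"
        by auto
      let ?h = "g \<oplus>\<^bsub>KQ\<^esub> (\<lambda>p. -1 * f p)"
      have h': "(\<lambda>p. -1 * f p) \<in> carrier KQ" by (rule scale_closed) (rule f)
      then have h: "?h \<in> carrier KQ" using g by (simp add: add_closed)
      moreover have "?h \<in> vanish z i" using h g by (auto simp: vanish_def add_apply)
      moreover have "\<Phi> (?h \<oplus>\<^bsub>KQ\<^esub> f) = \<Phi> g"
        using h g f by (subst uniserial_eq_iff) (auto simp: add_closed add_apply)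
      ultimately show "x \<in> (\<lambda>h. \<Phi> (h \<oplus>\<^bsub>KQ\<^esub> f)) ` vanish z i" using g by force
    qed (use f in \<open>auto simp: vanish_def add_closed add_apply intro!: imageI\<close>)
    finally show ?thesis .
  qed
  have carrier: "carrier ?M = ?\<Psi> ` carrier KQ"
  proof -
    have "carrier ?M = (\<lambda>x. \<Phi> ` vanish z i +>\<^bsub>M\<^esub> x) ` carrier M"
      by (auto simp: quot_module_def A_RCOSETS_def RCOSETS_def a_r_coset_def)
    also have "\<dots> = (\<lambda>f. \<Phi> ` vanish z i +>\<^bsub>M\<^esub> \<Phi> f) ` carrier KQ"
      by (auto simp: uniserial_carrier)
    also have "\<dots> = ?\<Psi> ` carrier KQ"
      by (rule image_cong[OF refl]) (rule coset)
    finally show ?thesis .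
  qed
  have add: "?\<Psi> f \<oplus>\<^bsub>?M\<^esub> ?\<Psi> g = ?\<Psi> (f \<oplus>\<^bsub>KQ\<^esub> g)" if f: "f \<in> carrier KQ" and g: "g \<in> carrier KQ" for f g
  proof -
    have "?\<Psi> f \<oplus>\<^bsub>?M\<^esub> ?\<Psi> g = (\<Union>a\<in>?\<Psi> f. \<Union>b\<in>?\<Psi> g. {a \<oplus>\<^bsub>M\<^esub> b})"
      by (simp add: quot_module_def set_add_def set_mult_def)
    also have "\<dots> = ?\<Psi> (f \<oplus>\<^bsub>KQ\<^esub> g)"
    proof (intro equalityI subsetI)
      fix x assume "x \<in> ?\<Psi> (f \<oplus>\<^bsub>KQ\<^esub> g)"
      then obtain h where h: "h \<in> carrier KQ" "x = \<Phi> h" "\<And>k. k < i \<Longrightarrow> h (pth Q z k) = f (pth Q z k) + g (pth Q z k)"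
        by (auto simp: add_apply)
      have f': "(\<lambda>p. -1 * f p) \<in> carrier KQ" by (rule scale_closed) (rule f)
      then have hf: "h \<oplus>\<^bsub>KQ\<^esub> (\<lambda>p. -1 * f p) \<in> carrier KQ" using h by (simp add: add_closed)
      have "x = \<Phi> f \<oplus>\<^bsub>M\<^esub> \<Phi> (h \<oplus>\<^bsub>KQ\<^esub> (\<lambda>p. -1 * f p))"
        using h(1) f hf unfolding h(2) uniserial_add[OF f hf] by (subst uniserial_eq_iff) (auto simp: add_apply add_closed)
      moreover have "\<Phi> f \<in> ?\<Psi> f" using f by auto
      moreover have "\<Phi> (h \<oplus>\<^bsub>KQ\<^esub> (\<lambda>p. -1 * f p)) \<in> ?\<Psi> g"
        using hf h by (auto simp: add_apply)
      ultimately show "x \<in> (\<Union>a\<in>?\<Psi> f. \<Union>b\<in>?\<Psi> g. {a \<oplus>\<^bsub>M\<^esub> b})" by blast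
    qed (auto simp: uniserial_add add_closed add_apply intro!: imageI)
    finally show ?thesis .
  qed
  have smult: "cls Q I f \<odot>\<^bsub>?M\<^esub> ?\<Psi> g = ?\<Psi> (f \<otimes>\<^bsub>KQ\<^esub> g)" if f: "f \<in> carrier KQ" and g: "g \<in> carrier KQ" for f g
  proof -
    have eq: "?\<Psi> (f \<otimes>\<^bsub>KQ\<^esub> h) = ?\<Psi> (f \<otimes>\<^bsub>KQ\<^esub> g)"
      if "\<And>k. k < i \<Longrightarrow> h (pth Q z k) = g (pth Q z k)" for h
    proof -
      have "(f \<otimes>\<^bsub>KQ\<^esub> h) (pth Q z k) = (f \<otimes>\<^bsub>KQ\<^esub> g) (pth Q z k)" if "k < i" for k
        unfolding mult_pth_apply using \<open>\<And>k. k < i \<Longrightarrow> h (pth Q z k) = g (pth Q z k)\<close> that by simp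
      then show ?thesis by simp
    qed
    have "cls Q I f \<odot>\<^bsub>?M\<^esub> ?\<Psi> g = (\<Union>x\<in>?\<Psi> g. \<Phi> ` vanish z i +>\<^bsub>M\<^esub> (cls Q I f \<odot>\<^bsub>M\<^esub> x))"
      by (simp add: quot_module_def)
    also have "\<dots> = (\<Union>x\<in>?\<Psi> g. ?\<Psi> (f \<otimes>\<^bsub>KQ\<^esub> g))"
    proof (intro SUP_cong refl)
      fix x assume "x \<in> ?\<Psi> g"
      then obtain h where h: "h \<in> carrier KQ" "x = \<Phi> h" "\<And>k. k < i \<Longrightarrow> h (pth Q z k) = g (pth Q z k)"
        by auto
      then show "\<Phi> ` vanish z i +>\<^bsub>M\<^esub> (cls Q I f \<odot>\<^bsub>M\<^esub> x) = ?\<Psi> (f \<otimes>\<^bsub>KQ\<^esub> g)"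
        using f eq[OF h(3)] by (simp only: uniserial_smult coset path_algebra_mult_closed)
    qed
    also have "\<dots> = ?\<Psi> (f \<otimes>\<^bsub>KQ\<^esub> g)" using g by auto
    finally show ?thesis .
  qed
  have eq_iff: "?\<Psi> f = ?\<Psi> g \<longleftrightarrow> (\<forall>k<i. f (pth Q z k) = g (pth Q z k))"
    if f: "f \<in> carrier KQ" and g: "g \<in> carrier KQ" for f g
  proof
    assume eq: "?\<Psi> f = ?\<Psi> g"
    have "\<Phi> f \<in> ?\<Psi> f" using f by auto
    then obtain h where h: "h \<in> carrier KQ" "\<Phi> f = \<Phi> h" "\<forall>k<i. h (pth Q z k) = g (pth Q z k)"
      using eq by auto
    then show "\<forall>k<i. f (pth Q z k) = g (pth Q z k)" using f i by (simp add: uniserial_eq_iff)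
  qed auto
  have zero: "\<zero>\<^bsub>?M\<^esub> = ?\<Psi> \<zero>\<^bsub>KQ\<^esub>"
    by (simp add: quot_module_def vanish_def zero_apply)
  show ?thesis
  proof (rule uniserialI)
    show "pth Q z k \<in> paths Q" if "k < i" for k using that i by (intro uniserial_paths) simp
  next
    fix f g assume fg: "f \<in> carrier KQ" "g \<in> carrier KQ"
    show "?\<Psi> f \<oplus>\<^bsub>?M\<^esub> ?\<Psi> g = ?\<Psi> (f \<oplus>\<^bsub>KQ\<^esub> g)" by (rule add[OF fg])
    show "cls Q I f \<odot>\<^bsub>?M\<^esub> ?\<Psi> g = ?\<Psi> (f \<otimes>\<^bsub>KQ\<^esub> g)" by (rule smult[OF fg])
    show "?\<Psi> f = ?\<Psi> g \<longleftrightarrow> (\<forall>k<i. f (pth Q z k) = g (pth Q z k))" by (rule eq_iff[OF fg])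
  qed (rule carrier, rule zero)
qed

text \<open>Right multiplication by \<open>pth Q z i\<close> puts this segment in front of every
  path, so it shifts coefficients by \<open>i\<close> positions. The radical powers of the submodule
  at \<open>i\<close> are thus those of the whole module with shifted index.\<close>

lemma uniserial_shift_vanish:
  assumes i: "i \<le> w" and j: "i \<le> j"
  shows "(\<lambda>f. \<Phi> (f \<otimes>\<^bsub>KQ\<^esub> path_elem (pth Q z i))) ` vanish (walk Q z i) (j - i) = \<Phi> ` vanish z j"
proof (intro equalityI subsetI)
  fix x assume "x \<in> (\<lambda>f. \<Phi> (f \<otimes>\<^bsub>KQ\<^esub> path_elem (pth Q z i))) ` vanish (walk Q z i) (j - i)"
  then obtain f where f: "f \<in> carrier KQ" "\<And>k. k < j - i \<Longrightarrow> f (pth Q (walk Q z i) k) = 0"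
    "x = \<Phi> (f \<otimes>\<^bsub>KQ\<^esub> path_elem (pth Q z i))" by (auto simp: vanish_def)
  then show "x \<in> \<Phi> ` vanish z j"
    using mult_path_elem_closed[OF f(1) uniserial_start[OF i]]
    by (auto simp: vanish_def mult_path_elem_pth_apply intro!: imageI)
next
  fix x assume "x \<in> \<Phi> ` vanish z j"
  then obtain g where g: "g \<in> carrier KQ" "\<And>k. k < j \<Longrightarrow> g (pth Q z k) = 0" "x = \<Phi> g"
    by (auto simp: vanish_def)
  \<comment> \<open>The preimage cuts the segment \<open>pth Q z i\<close> off the paths of
    \<open>g\<close>. The restriction to members of \<open>paths Q\<close> loses nothing, since
    \<open>g\<close> is zero outside \<open>paths Q\<close>.\<close>
  define f where "f p = (if p \<in> paths Q \<and> hd p = walk Q z i then g (pth Q z i @ tl p) else 0)" for p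
  have tl: "tl p = tl q \<Longrightarrow> hd p = hd q \<Longrightarrow> p \<in> paths Q \<Longrightarrow> q \<in> paths Q \<Longrightarrow> p = q" for p q
    by (cases p; cases q) (auto simp: paths_def)
  have "finite {p. f p \<noteq> 0}"
  proof (rule finite_imageD)
    show "inj_on (\<lambda>p. pth Q z i @ tl p) {p. f p \<noteq> 0}"
      by (rule inj_onI) (auto simp: f_def intro: tl split: if_splits)
    show "finite ((\<lambda>p. pth Q z i @ tl p) ` {p. f p \<noteq> 0})"
      by (rule finite_subset[of _ "{p. g p \<noteq> 0}"]) (use g in \<open>auto simp: mem_path_algebra f_def split: if_splits\<close>)
  qed
  then have f: "f \<in> carrier KQ" by (auto simp: mem_path_algebra f_def split: if_splits)
  have f_pth: "f (pth Q (walk Q z i) k) = g (pth Q z (i + k))" for k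
  proof (cases "pth Q (walk Q z i) k \<in> paths Q")
    case True
    then show ?thesis by (simp add: f_def pth_append)
  next
    case False
    then have "pth Q z (i + k) \<notin> paths Q"
      using pth_walk_paths[of z "i + k" i] by auto
    then show ?thesis using False g by (simp add: f_def path_algebra_eq_0)
  qed
  have "\<Phi> g = \<Phi> (f \<otimes>\<^bsub>KQ\<^esub> path_elem (pth Q z i))"
    using g mult_path_elem_closed[OF f uniserial_start[OF i]] j
    by (subst uniserial_eq_iff) (auto simp: mult_path_elem_pth_apply f_pth)
  moreover have "f \<in> vanish (walk Q z i) (j - i)"
    using f g by (auto simp: vanish_def f_pth)
  ultimately show "x \<in> (\<lambda>f. \<Phi> (f \<otimes>\<^bsub>KQ\<^esub> path_elem (pth Q z i))) ` vanish (walk Q z i) (j - i)"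
    using g by auto
qed

text \<open>The submodule is generated by \<open>pth Q z i\<close> times the generator of
  \<open>M\<close>, an element living at the vertex \<open>walk Q z i\<close>. For
  \<open>i = w\<close> it is zero, and that path may have left the quiver.\<close>

lemma uniserial_restrict:
  assumes i: "i \<le> w"
  shows "uniserial (M\<lparr>carrier := \<Phi> ` vanish z i\<rparr>) (walk Q z i) (w - i)
    (\<lambda>f. \<Phi> (f \<otimes>\<^bsub>KQ\<^esub> path_elem (pth Q z i)))" (is "uniserial ?M _ _ ?\<Psi>")
proof -
  note cl = mult_path_elem_closed[OF _ uniserial_start[OF i]]
  have carrier: "carrier ?M = ?\<Psi> ` carrier KQ"
    using uniserial_shift_vanish[OF i order_refl] by (simp add: vanish_def)
  have paths: "pth Q (walk Q z i) k \<in> paths Q" if "k < w - i" for k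
    using that pth_walk_paths[OF uniserial_paths[of "i + k"], of i] by simp
  have "\<zero>\<^bsub>KQ\<^esub> \<otimes>\<^bsub>KQ\<^esub> path_elem (pth Q z i) = \<zero>\<^bsub>KQ\<^esub>"
    by (simp add: path_algebra_def)
  then have zero: "\<zero>\<^bsub>?M\<^esub> = ?\<Psi> \<zero>\<^bsub>KQ\<^esub>"
    by (simp add: uniserial_zero)
  have eq_iff: "?\<Psi> f = ?\<Psi> g \<longleftrightarrow> (\<forall>k<w - i. f (pth Q (walk Q z i) k) = g (pth Q (walk Q z i) k))"
    if f: "f \<in> carrier KQ" and g: "g \<in> carrier KQ" for f g
  proof -
    have "?\<Psi> f = ?\<Psi> g \<longleftrightarrow> (\<forall>k<w. i \<le> k \<longrightarrow> f (pth Q (walk Q z i) (k - i)) = g (pth Q (walk Q z i) (k - i)))"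
      by (subst uniserial_eq_iff[OF cl[OF f] cl[OF g]]) (auto simp: mult_path_elem_pth_apply)
    also have "\<dots> \<longleftrightarrow> (\<forall>k<w - i. f (pth Q (walk Q z i) k) = g (pth Q (walk Q z i) k))"
    proof safe
      fix k assume *: "\<forall>k<w. i \<le> k \<longrightarrow> f (pth Q (walk Q z i) (k - i)) = g (pth Q (walk Q z i) (k - i))" "k < w - i"
      show "f (pth Q (walk Q z i) k) = g (pth Q (walk Q z i) k)"
        using spec[OF *(1), of "i + k"] *(2) by simp
    qed simp
    finally show ?thesis .
  qed
  have add: "?\<Psi> f \<oplus>\<^bsub>?M\<^esub> ?\<Psi> g = ?\<Psi> (f \<oplus>\<^bsub>KQ\<^esub> g)" if f: "f \<in> carrier KQ" and g: "g \<in> carrier KQ" for f g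
    using uniserial_add[OF cl[OF f] cl[OF g]] by (simp only: mult_l_distr) simp
  have smult: "cls Q I f \<odot>\<^bsub>?M\<^esub> ?\<Psi> g = ?\<Psi> (f \<otimes>\<^bsub>KQ\<^esub> g)" if f: "f \<in> carrier KQ" and g: "g \<in> carrier KQ" for f g
    using uniserial_smult[OF f cl[OF g]] by (simp only: path_algebra_mult_assoc) simp
  show ?thesis
  proof (rule uniserialI)
    fix f g assume fg: "f \<in> carrier KQ" "g \<in> carrier KQ"
    show "?\<Psi> f \<oplus>\<^bsub>?M\<^esub> ?\<Psi> g = ?\<Psi> (f \<oplus>\<^bsub>KQ\<^esub> g)" by (rule add[OF fg])
    show "cls Q I f \<odot>\<^bsub>?M\<^esub> ?\<Psi> g = ?\<Psi> (f \<otimes>\<^bsub>KQ\<^esub> g)" by (rule smult[OF fg])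
    show "?\<Psi> f = ?\<Psi> g \<longleftrightarrow> (\<forall>k<w - i. f (pth Q (walk Q z i) k) = g (pth Q (walk Q z i) k))"
      by (rule eq_iff[OF fg])
  qed (erule paths, rule carrier, rule zero)
qed

end

section \<open>Homomorphisms and isomorphisms\<close>

lemma module_homD:
  assumes "f \<in> module_hom R M N"
  shows "x \<in> carrier M \<Longrightarrow> f x \<in> carrier N"
    and "a \<in> carrier R \<Longrightarrow> x \<in> carrier M \<Longrightarrow> f (a \<odot>\<^bsub>M\<^esub> x) = a \<odot>\<^bsub>N\<^esub> f x"
  using assms by (auto simp: module_hom_def)

lemma uniserial_map:
  assumes "\<And>f g. f \<in> carrier KQ \<Longrightarrow> g \<in> carrier KQ \<Longrightarrow> \<Phi> f = \<Phi> g \<Longrightarrow> \<Psi> f = \<Psi> g"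
  obtains \<theta> where "\<And>f. f \<in> carrier KQ \<Longrightarrow> \<theta> (\<Phi> f) = \<Psi> f"
proof
  fix f assume f: "f \<in> carrier KQ"
  let ?g = "SOME g. g \<in> carrier KQ \<and> \<Phi> g = \<Phi> f"
  have "?g \<in> carrier KQ \<and> \<Phi> ?g = \<Phi> f" by (rule someI[of _ f]) (simp add: f)
  then show "(\<lambda>u. \<Psi> (SOME g. g \<in> carrier KQ \<and> \<Phi> g = u)) (\<Phi> f) = \<Psi> f"
    using assms f by blast
qed

text \<open>The generator of \<open>M\<close> is sent to \<open>pth Q z' i\<close> times the
  generator of \<open>M'\<close>. The case \<open>i = 0\<close> serves for isomorphisms and the
  identity, a cycle for endomorphisms that are not scalars.\<close>

lemma uniserial_hom:
  assumes u: "uniserial M z w \<Phi>" and u': "uniserial M' z' w' \<Phi>'" and g: "i = 0 \<or> z' \<in> verts Q" "walk Q z' i = z"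
    and \<theta>: "\<And>f. f \<in> carrier KQ \<Longrightarrow> \<theta> (\<Phi> f) = \<Phi>' (f \<otimes>\<^bsub>KQ\<^esub> path_elem (pth Q z' i))"
  shows "\<theta> \<in> module_hom A M M'"
proof -
  note cl = mult_path_elem_closed[OF _ g(1)]
  have "\<theta> (\<Phi> f) \<in> carrier M'" if "f \<in> carrier KQ" for f
    using \<theta>[OF that] cl[OF that] uniserial_carrier[OF u'] by auto
  moreover have "\<theta> (\<Phi> f \<oplus>\<^bsub>M\<^esub> \<Phi> h) = \<theta> (\<Phi> f) \<oplus>\<^bsub>M'\<^esub> \<theta> (\<Phi> h)"
    if f: "f \<in> carrier KQ" and h: "h \<in> carrier KQ" for f h
    unfolding uniserial_add[OF u f h] \<theta>[OF add_closed[OF f h]] \<theta>[OF f] \<theta>[OF h]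
      uniserial_add[OF u' cl[OF f] cl[OF h]] mult_l_distr ..
  moreover have "\<theta> (cls Q I f \<odot>\<^bsub>M\<^esub> \<Phi> h) = cls Q I f \<odot>\<^bsub>M'\<^esub> \<theta> (\<Phi> h)"
    if f: "f \<in> carrier KQ" and h: "h \<in> carrier KQ" for f h
    unfolding uniserial_smult[OF u f h] \<theta>[OF path_algebra_mult_closed[OF f h]] \<theta>[OF h]
      uniserial_smult[OF u' f cl[OF h]] path_algebra_mult_assoc ..
  ultimately show ?thesis
    unfolding module_hom_def uniserial_carrier[OF u] carrier_A by blast
qed

lemma KQ_l_one: "f \<in> carrier KQ \<Longrightarrow> \<one>\<^bsub>KQ\<^esub> \<otimes>\<^bsub>KQ\<^esub> f = f"
  and KQ_l_null: "f \<in> carrier KQ \<Longrightarrow> \<zero>\<^bsub>KQ\<^esub> \<otimes>\<^bsub>KQ\<^esub> f = \<zero>\<^bsub>KQ\<^esub>"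
  by simp_all

lemma uniserial_mult_start:
  assumes u: "uniserial M z w \<Phi>" and f: "f \<in> carrier KQ"
  shows "\<Phi> (f \<otimes>\<^bsub>KQ\<^esub> path_elem [z]) = \<Phi> f"
  using f mult_path_elem_closed[OF f, of 0 z] mult_path_elem_pth_apply[of Q f z 0 z]
  by (subst uniserial_eq_iff[OF u]) auto

lemma uniserial_isoI:
  assumes u: "uniserial M z w \<Phi>" and u': "uniserial M' z w \<Phi>'"
  shows "module_iso A M M'"
proof -
  have eq: "\<Phi> f = \<Phi> g \<longleftrightarrow> \<Phi>' f = \<Phi>' g" if "f \<in> carrier KQ" "g \<in> carrier KQ" for f g
    using uniserial_eq_iff[OF u that] uniserial_eq_iff[OF u' that] by simp
  obtain \<theta> where \<theta>: "\<And>f. f \<in> carrier KQ \<Longrightarrow> \<theta> (\<Phi> f) = \<Phi>' f"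
    using uniserial_map[of \<Phi> \<Phi>'] eq by blast
  have "\<theta> \<in> module_hom A M M'"
    using \<theta> uniserial_mult_start[OF u'] by (intro uniserial_hom[OF u u', of 0]) auto
  moreover have "bij_betw \<theta> (carrier M) (carrier M')"
    unfolding uniserial_carrier[OF u] uniserial_carrier[OF u'] bij_betw_def
    using \<theta> eq by (auto simp: inj_on_def image_image)
  ultimately show ?thesis unfolding module_iso_def by blast
qed

text \<open>The isomorphism is \<open>f \<mapsto> f g\<close> for an image \<open>g\<close> of the
  generator. Surjectivity forces \<open>g [z'] \<noteq> 0\<close>; the trivial path at
  \<open>z\<close> fixes the generator, so \<open>z = z'\<close>. The length is read off from the
  paths that annihilate the generator. Zero modules have no well-defined top, whence
  \<open>w > 0\<close>.\<close>

lemma uniserial_iso_unique: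
  assumes u: "uniserial M z w \<Phi>" and u': "uniserial M' z' w' \<Phi>'" and iso: "module_iso A M M'" and w: "w > 0"
  shows "z = z' \<and> w = w'"
proof -
  obtain \<theta> where \<theta>: "\<theta> \<in> module_hom A M M'" and bij: "bij_betw \<theta> (carrier M) (carrier M')"
    using iso by (auto simp: module_iso_def)
  have one: "\<Phi> \<one>\<^bsub>KQ\<^esub> \<in> carrier M" by (simp add: uniserial_carrier[OF u])
  obtain g where g: "g \<in> carrier KQ" "\<theta> (\<Phi> \<one>\<^bsub>KQ\<^esub>) = \<Phi>' g"
    using module_homD(1)[OF \<theta> one] by (auto simp: uniserial_carrier[OF u'])
  have \<theta>_eq: "\<theta> (\<Phi> f) = \<Phi>' (f \<otimes>\<^bsub>KQ\<^esub> g)" if f: "f \<in> carrier KQ" for f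
  proof -
    have "\<theta> (\<Phi> f) = \<theta> (cls Q I f \<odot>\<^bsub>M\<^esub> \<Phi> \<one>\<^bsub>KQ\<^esub>)"
      using f by (simp add: uniserial_smult[OF u])
    also have "\<dots> = cls Q I f \<odot>\<^bsub>M'\<^esub> \<Phi>' g"
      using f one g by (simp add: module_homD(2)[OF \<theta>] carrier_A)
    finally show ?thesis using f g by (simp add: uniserial_smult[OF u'])
  qed
  have inj: "\<Phi> f = \<Phi> h \<longleftrightarrow> \<Phi>' (f \<otimes>\<^bsub>KQ\<^esub> g) = \<Phi>' (h \<otimes>\<^bsub>KQ\<^esub> g)"
    if "f \<in> carrier KQ" "h \<in> carrier KQ" for f h
    using bij that by (auto simp: \<theta>_eq[symmetric] bij_betw_def uniserial_carrier[OF u] dest: inj_onD)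
  have z: "z \<in> verts Q" using uniserial_start[OF u, of w] uniserial_paths[OF u, of 0] w by (simp add: paths_def)
  have w': "w' > 0"
  proof (rule ccontr)
    assume "\<not> w' > 0"
    then have "\<Phi> \<one>\<^bsub>KQ\<^esub> = \<Phi> \<zero>\<^bsub>KQ\<^esub>"
      using g by (subst inj) (auto simp: uniserial_eq_iff[OF u'])
    then have "\<one>\<^bsub>KQ\<^esub> (pth Q z 0) = (\<zero>\<^bsub>KQ\<^esub> (pth Q z 0) :: 'k)"
      using w uniserial_eq_iff[OF u] by blast
    then show False using z unfolding one_pth_apply zero_apply by simp
  qed
  have z': "z' \<in> verts Q" using uniserial_paths[OF u' w'] by (simp add: paths_def)
  have "\<Phi>' \<one>\<^bsub>KQ\<^esub> \<in> \<theta> ` carrier M"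
    using bij by (simp add: bij_betw_def uniserial_carrier[OF u'])
  then obtain f where f: "f \<in> carrier KQ" "\<Phi>' \<one>\<^bsub>KQ\<^esub> = \<Phi>' (f \<otimes>\<^bsub>KQ\<^esub> g)"
    by (auto simp: uniserial_carrier[OF u] \<theta>_eq)
  then have "\<one>\<^bsub>KQ\<^esub> (pth Q z' 0) = (f \<otimes>\<^bsub>KQ\<^esub> g) (pth Q z' 0)"
    using g w' uniserial_eq_iff[OF u', of "\<one>\<^bsub>KQ\<^esub>" "f \<otimes>\<^bsub>KQ\<^esub> g"] by blast
  then have g0: "g [z'] \<noteq> 0"
    using z' unfolding one_pth_apply mult_pth_apply by auto
  have e: "path_elem (pth Q z 0) \<in> carrier KQ"
    by (rule path_elem_closed[OF uniserial_paths[OF u w]])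
  have "\<Phi> (path_elem (pth Q z 0)) = \<Phi> \<one>\<^bsub>KQ\<^esub>"
    using e z by (subst uniserial_eq_iff[OF u]) (auto simp: one_pth_apply path_elem_def[of "pth Q z 0"] simp del: pth_0)
  then have "\<Phi>' (path_elem (pth Q z 0) \<otimes>\<^bsub>KQ\<^esub> g) = \<Phi>' g"
    using inj[OF e one_closed] KQ_l_one[OF g(1)] by simp
  then have "(path_elem (pth Q z 0) \<otimes>\<^bsub>KQ\<^esub> g) (pth Q z' 0) = g (pth Q z' 0)"
    using e g w' uniserial_eq_iff[OF u', of "path_elem (pth Q z 0) \<otimes>\<^bsub>KQ\<^esub> g" g] by blast
  then have zz': "z = z'"
    using g0 unfolding path_elem_mult_pth_apply by (simp split: if_splits)
  \<comment> \<open>Both sides say that the path with \<open>k\<close> arrows does not annihilate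
    the generator, seen in \<open>M\<close> and in \<open>M'\<close>. On the right the witness is
    \<open>l = k\<close>, with coefficient \<open>g [z']\<close>.\<close>
  have kill: "k < w \<longleftrightarrow> k < w'" if k: "pth Q z k \<in> paths Q" for k
  proof -
    note p = path_elem_closed[OF k]
    have "k < w \<longleftrightarrow> \<Phi> (path_elem (pth Q z k)) \<noteq> \<Phi> \<zero>\<^bsub>KQ\<^esub>"
      using p by (subst uniserial_eq_iff[OF u]) (auto simp: path_elem_def[of "pth Q z k"] zero_apply)
    also have "\<dots> \<longleftrightarrow> \<Phi>' (path_elem (pth Q z k) \<otimes>\<^bsub>KQ\<^esub> g) \<noteq> \<Phi>' \<zero>\<^bsub>KQ\<^esub>"
      using p g(1) by (subst inj) auto
    also have "\<dots> \<longleftrightarrow> (\<exists>l<w'. k \<le> l \<and> walk Q z (l - k) = z \<and> g (pth Q z (l - k)) \<noteq> 0)"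
      using p g(1) zz' by (subst uniserial_eq_iff[OF u']) (auto simp: path_elem_mult_pth_apply zero_apply)
    also have "\<dots> \<longleftrightarrow> k < w'"
      using g0 zz' by (auto intro: exI[of _ k])
    finally show ?thesis .
  qed
  have "\<not> w < w'" using kill[of w] uniserial_paths[OF u', of w] zz' by auto
  moreover have "\<not> w' < w" using kill[of w'] uniserial_paths[OF u, of w'] by auto
  ultimately show ?thesis using zz' by simp
qed

text \<open>For use when only the second module is known to be nonzero: a filtration may a priori
  have zero layers, but no Weyl module is zero.\<close>

lemma uniserial_iso_pos:
  assumes u: "uniserial M z w \<Phi>" and u': "uniserial M' z' w' \<Phi>'" and iso: "module_iso A M M'" and w': "w' > 0"
  shows "w > 0"
proof (rule ccontr)
  assume "\<not> w > 0"
  then have M: "carrier M = {\<zero>\<^bsub>M\<^esub>}"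
    using uniserial_vanish_zero[OF u] uniserial_vanish_all[OF u] by simp
  obtain \<theta> where "bij_betw \<theta> (carrier M) (carrier M')"
    using iso by (auto simp: module_iso_def)
  then have "carrier M' = {\<theta> \<zero>\<^bsub>M\<^esub>}" by (simp add: bij_betw_def M)
  moreover have "\<Phi>' \<one>\<^bsub>KQ\<^esub> \<in> carrier M'" "\<Phi>' \<zero>\<^bsub>KQ\<^esub> \<in> carrier M'"
    by (simp_all add: uniserial_carrier[OF u'])
  ultimately have "\<Phi>' \<one>\<^bsub>KQ\<^esub> = \<Phi>' \<zero>\<^bsub>KQ\<^esub>" by simp
  then have "\<one>\<^bsub>KQ\<^esub> (pth Q z' 0) = (\<zero>\<^bsub>KQ\<^esub> (pth Q z' 0) :: 'k)"
    using w' uniserial_eq_iff[OF u' one_closed zero_closed] by blast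
  then show False
    using uniserial_paths[OF u' w'] unfolding one_pth_apply zero_apply by (simp add: paths_def)
qed

lemma uniserial_simple_iff:
  assumes u: "uniserial M z w \<Phi>"
  shows "simple_module A M \<longleftrightarrow> w = 1"
proof
  assume s: "simple_module A M"
  have eqD: "i = j" if "\<Phi> ` vanish z i = \<Phi> ` vanish z j" "i \<le> w" "j \<le> w" for i j
    using that uniserial_subset_iff[OF u] by (metis order_antisym order_refl)
  have "w \<noteq> 0"
    using s uniserial_vanish_zero[OF u] uniserial_vanish_all[OF u] by (auto simp: simple_module_def)
  then have "submodule (\<Phi> ` vanish z 1) A M" by (intro uniserial_submodule[OF u]) simp
  then have "\<Phi> ` vanish z 1 = \<Phi> ` vanish z w \<or> \<Phi> ` vanish z 1 = \<Phi> ` vanish z 0"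
    using s unfolding simple_module_def uniserial_vanish_zero[OF u] uniserial_vanish_all[OF u] by blast
  then show "w = 1" using eqD[of 1 w] eqD[of 1 0] \<open>w \<noteq> 0\<close> by auto
next
  assume w: "w = 1"
  have "\<not> \<Phi> ` vanish z 0 \<subseteq> \<Phi> ` vanish z w"
    using uniserial_subset_iff[OF u, of 0 w] w by simp
  then have "carrier M \<noteq> {\<zero>\<^bsub>M\<^esub>}"
    unfolding uniserial_vanish_zero[OF u] uniserial_vanish_all[OF u] by auto
  moreover have "N = {\<zero>\<^bsub>M\<^esub>} \<or> N = carrier M" if N: "submodule N A M" for N
  proof -
    obtain i where i: "i \<le> w" "N = \<Phi> ` vanish z i" using uniserial_submodule_cases[OF u N] .
    then have "i = 0 \<or> i = w" using w by auto
    then show ?thesis using i uniserial_vanish_zero[OF u] uniserial_vanish_all[OF u] by auto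
  qed
  ultimately show "simple_module A M" by (simp add: simple_module_def)
qed

section \<open>Filtrations and composition factors\<close>

lemma uniserial_subquotient:
  assumes u: "uniserial M z w \<Phi>" and ij: "i \<le> j" "j \<le> w"
  shows "\<exists>\<Psi>. uniserial (quot_module (M\<lparr>carrier := \<Phi> ` vanish z i\<rparr>) (\<Phi> ` vanish z j)) (walk Q z i) (j - i) \<Psi>"
proof -
  have "i \<le> w" using ij by simp
  note r = uniserial_restrict[OF u this]
  have "j - i \<le> w - i" using ij by simp
  note q = uniserial_quotient[OF r this]
  show ?thesis using q unfolding uniserial_shift_vanish[OF u \<open>i \<le> w\<close> ij(1)] by blast
qed

text \<open>A filtration grows from the socle upwards while \<open>vanish\<close> counts from the
  top downwards, so it is encoded by indices falling from \<open>w\<close> to \<open>0\<close>.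
  Layer \<open>k\<close> occupies the positions from \<open>a (Suc k)\<close> to just before
  \<open>a k\<close>.\<close>

lemma uniserial_filtrationE:
  assumes u: "uniserial M z w \<Phi>" and F: "filtration A M t F"
  obtains a where "\<And>k. k \<le> t \<Longrightarrow> a k \<le> w" "a 0 = w" "a t = 0" "\<And>k. k < t \<Longrightarrow> a (Suc k) \<le> a k"
    "\<And>k. k < t \<Longrightarrow> \<exists>\<Psi>. uniserial (layer M F k) (walk Q z (a (Suc k))) (a k - a (Suc k)) \<Psi>"
proof -
  have "\<forall>k. \<exists>i. k \<le> t \<longrightarrow> i \<le> w \<and> F k = \<Phi> ` vanish z i"
    using F uniserial_submodule_cases[OF u] unfolding filtration_def by metis
  then obtain a where a: "\<And>k. k \<le> t \<Longrightarrow> a k \<le> w" "\<And>k. k \<le> t \<Longrightarrow> F k = \<Phi> ` vanish z (a k)"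
    by metis
  have "\<Phi> ` vanish z (a 0) \<subseteq> \<Phi> ` vanish z w"
    using a(2)[of 0] F by (simp add: filtration_def uniserial_vanish_zero[OF u])
  then have a0: "a 0 = w" using uniserial_subset_iff[OF u] a(1)[of 0] by simp
  have "\<Phi> ` vanish z 0 \<subseteq> \<Phi> ` vanish z (a t)"
    using a(2)[of t] F by (simp add: filtration_def uniserial_vanish_all[OF u])
  then have at: "a t = 0" using uniserial_subset_iff[OF u] a(1)[of t] by simp
  have mono: "a (Suc k) \<le> a k" if "k < t" for k
    using that F a uniserial_subset_iff[OF u, of "a k" "a (Suc k)"] by (simp add: filtration_def)
  have "\<exists>\<Psi>. uniserial (layer M F k) (walk Q z (a (Suc k))) (a k - a (Suc k)) \<Psi>" if k: "k < t" for k
    using uniserial_subquotient[OF u mono[OF k] a(1)[of k]] k a(2)[of k] a(2)[of "Suc k"]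
    unfolding layer_def by auto
  then show thesis using that a(1) a0 at mono by blast
qed

lemma uniserial_filtrationI:
  assumes u: "uniserial M z w \<Phi>" and a: "a 0 = w" "a t = 0" "\<And>k. k < t \<Longrightarrow> a (Suc k) \<le> a k"
  shows "filtration A M t (\<lambda>k. \<Phi> ` vanish z (a k))"
    and "k < t \<Longrightarrow> \<exists>\<Psi>. uniserial (layer M (\<lambda>k. \<Phi> ` vanish z (a k)) k) (walk Q z (a (Suc k))) (a k - a (Suc k)) \<Psi>"
proof -
  have le: "a k \<le> w" if "k \<le> t" for k
    using that
  proof (induction k)
    case (Suc k)
    then show ?case using a(3)[of k] by simp
  qed (simp add: a)
  have "submodule (\<Phi> ` vanish z (a k)) A M" if "k \<le> t" for k
    using le[OF that] by (rule uniserial_submodule[OF u])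
  then show "filtration A M t (\<lambda>k. \<Phi> ` vanish z (a k))"
    unfolding filtration_def using a uniserial_vanish_zero[OF u] uniserial_vanish_all[OF u] uniserial_vanish_mono[OF u]
    by simp
  show "\<exists>\<Psi>. uniserial (layer M (\<lambda>k. \<Phi> ` vanish z (a k)) k) (walk Q z (a (Suc k))) (a k - a (Suc k)) \<Psi>" if "k < t"
    using uniserial_subquotient[OF u a(3)[OF that] le[of k]] that unfolding layer_def by auto
qed

text \<open>The layers of a composition series have length one, so each is a single position of the
  walk; conversely the radical series passes through every position.\<close>

lemma uniserial_composition_factor_iff:
  assumes u: "uniserial M z w \<Phi>" and s: "\<And>y. y \<in> verts Q \<Longrightarrow> \<exists>\<Psi>. uniserial (simple_at Q I y) y 1 \<Psi>"
  shows "composition_factor Q I M y \<longleftrightarrow> (\<exists>i<w. y = walk Q z i)"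
proof
  assume "composition_factor Q I M y"
  then obtain t F i where y: "y \<in> verts Q" and F: "composition_series A M t F" and i: "i < t"
    and iso: "module_iso A (layer M F i) (simple_at Q I y)"
    unfolding composition_factor_def by blast
  obtain a where a: "\<And>k. k \<le> t \<Longrightarrow> a k \<le> w"
    "\<And>k. k < t \<Longrightarrow> \<exists>\<Psi>. uniserial (layer M F k) (walk Q z (a (Suc k))) (a k - a (Suc k)) \<Psi>"
    using uniserial_filtrationE[OF u] F unfolding composition_series_def by metis
  obtain \<Psi> where \<Psi>: "uniserial (layer M F i) (walk Q z (a (Suc i))) (a i - a (Suc i)) \<Psi>"
    using a(2)[OF i] by blast
  have "simple_module A (layer M F i)" using F i by (simp add: composition_series_def)
  then have 1: "a i - a (Suc i) = 1" using uniserial_simple_iff[OF \<Psi>] by simp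
  obtain \<Psi>' where "uniserial (simple_at Q I y) y 1 \<Psi>'" using s[OF y] by blast
  from uniserial_iso_unique[OF \<Psi> this iso] 1 have "y = walk Q z (a (Suc i))" by simp
  moreover have "a (Suc i) < w" using 1 a(1)[of i] i by linarith
  ultimately show "\<exists>i<w. y = walk Q z i" by blast
next
  assume "\<exists>i<w. y = walk Q z i"
  then obtain i where i: "i < w" "y = walk Q z i" by blast
  have y: "y \<in> verts Q" using uniserial_paths[OF u i(1)] i(2) by (simp add: pth_in_paths_iff)
  \<comment> \<open>The radical series read from the socle: position \<open>i\<close> is the top of
    layer \<open>w - Suc i\<close>.\<close>
  let ?F = "\<lambda>k. \<Phi> ` vanish z (w - k)"
  have F: "filtration A M w ?F" by (rule uniserial_filtrationI(1)[OF u]) auto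
  have lay: "\<exists>\<Psi>. uniserial (layer M ?F k) (walk Q z (w - Suc k)) 1 \<Psi>" if "k < w" for k
    using uniserial_filtrationI(2)[OF u, of "\<lambda>k. w - k" w k] that by simp
  then have "composition_series A M w ?F"
    unfolding composition_series_def using F uniserial_simple_iff by metis
  moreover have "module_iso A (layer M ?F (w - Suc i)) (simple_at Q I y)"
  proof -
    obtain \<Psi> where "uniserial (layer M ?F (w - Suc i)) y 1 \<Psi>"
      using lay[of "w - Suc i"] i by auto
    moreover obtain \<Psi>' where "uniserial (simple_at Q I y) y 1 \<Psi>'" using s[OF y] by blast
    ultimately show ?thesis by (rule uniserial_isoI)
  qed
  moreover have "w - Suc i < w" using i by simp
  ultimately show "composition_factor Q I M y" unfolding composition_factor_def using y by blast
qed

section \<open>Endomorphism rings\<close>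

lemma scale_one_closed: "(\<lambda>p. c * \<one>\<^bsub>KQ\<^esub> p) \<in> carrier KQ"
  by (rule scale_closed) (rule one_closed)

lemma mult_scale_one: "f \<in> carrier KQ \<Longrightarrow> f \<otimes>\<^bsub>KQ\<^esub> (\<lambda>p. c * \<one>\<^bsub>KQ\<^esub> p) = (\<lambda>p. c * f p)"
  and scale_one_mult: "f \<in> carrier KQ \<Longrightarrow> (\<lambda>p. c * \<one>\<^bsub>KQ\<^esub> p) \<otimes>\<^bsub>KQ\<^esub> f = (\<lambda>p. c * f p)"
  unfolding mult_scale scale_mult by simp_all

context
  fixes M :: "((nat list \<Rightarrow> 'k) set, 'b) module" and z w \<Phi>
  assumes u: "uniserial M z w \<Phi>" and w: "w > 0"
begin

lemma uniserial_verts: "z \<in> verts Q"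
  using uniserial_paths[OF u w] by (simp add: paths_def)

lemma uniserial_mem: "f \<in> carrier KQ \<Longrightarrow> \<Phi> f \<in> carrier M"
  by (simp add: uniserial_carrier[OF u])

lemma End_ringD:
  assumes "\<theta> \<in> carrier (End_ring A M)"
  shows "\<theta> \<in> module_hom A M M" "\<theta> \<in> extensional (carrier M)"
  using assms by (simp_all add: End_ring_def)

lemma End_ring_eqI:
  assumes "\<theta> \<in> extensional (carrier M)" "\<psi> \<in> extensional (carrier M)"
    and "\<And>f. f \<in> carrier KQ \<Longrightarrow> \<theta> (\<Phi> f) = \<psi> (\<Phi> f)"
  shows "\<theta> = \<psi>"
  by (rule extensionalityI[OF assms(1,2)]) (use assms(3) uniserial_carrier[OF u] in auto)

lemma End_ring_apply:
  assumes \<theta>: "\<theta> \<in> carrier (End_ring A M)" and "\<theta> (\<Phi> \<one>\<^bsub>KQ\<^esub>) = \<Phi> g" "g \<in> carrier KQ" and f: "f \<in> carrier KQ"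
  shows "\<theta> (\<Phi> f) = \<Phi> (f \<otimes>\<^bsub>KQ\<^esub> g)"
proof -
  have "\<theta> (\<Phi> f) = \<theta> (cls Q I f \<odot>\<^bsub>M\<^esub> \<Phi> \<one>\<^bsub>KQ\<^esub>)"
    using f by (simp add: uniserial_smult[OF u])
  also have "\<dots> = cls Q I f \<odot>\<^bsub>M\<^esub> \<Phi> g"
    using f assms by (simp add: module_homD(2)[OF End_ringD(1)[OF \<theta>]] carrier_A uniserial_mem)
  finally show ?thesis using f assms by (simp add: uniserial_smult[OF u])
qed

lemma End_ring_id: "\<one>\<^bsub>End_ring A M\<^esub> \<in> carrier (End_ring A M)"
proof -
  have "(\<lambda>x\<in>carrier M. x) \<in> module_hom A M M"
    by (rule uniserial_hom[OF u u, of 0]) (auto simp: uniserial_verts uniserial_mem uniserial_mult_start[OF u])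
  then show ?thesis by (simp add: End_ring_def)
qed

lemma End_ring_comp:
  assumes "\<theta> \<in> carrier (End_ring A M)" "\<psi> \<in> carrier (End_ring A M)"
  shows "\<theta> \<otimes>\<^bsub>End_ring A M\<^esub> \<psi> \<in> carrier (End_ring A M)"
proof -
  interpret M: abelian_group M by (rule uniserial_abelian_group[OF u])
  have sm: "a \<odot>\<^bsub>M\<^esub> x \<in> carrier M" if "a \<in> carrier A" "x \<in> carrier M" for a x
    using that by (auto simp: carrier_A uniserial_carrier[OF u] uniserial_smult[OF u] path_algebra_mult_closed)
  have "compose (carrier M) \<theta> \<psi> \<in> module_hom A M M"
    using assms sm unfolding End_ring_def module_hom_def compose_def
    by (auto simp: Pi_iff)
  then show ?thesis by (simp add: End_ring_def)
qed

lemma End_ring_zero: "\<zero>\<^bsub>End_ring A M\<^esub> \<in> carrier (End_ring A M)"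
proof -
  interpret M: abelian_group M by (rule uniserial_abelian_group[OF u])
  have sm: "a \<odot>\<^bsub>M\<^esub> x \<in> carrier M" if "a \<in> carrier A" "x \<in> carrier M" for a x
    using that by (auto simp: carrier_A uniserial_carrier[OF u] uniserial_smult[OF u] path_algebra_mult_closed)
  have sm0: "a \<odot>\<^bsub>M\<^esub> \<zero>\<^bsub>M\<^esub> = \<zero>\<^bsub>M\<^esub>" if "a \<in> carrier A" for a
    using that by (auto simp: carrier_A uniserial_zero[OF u] uniserial_smult[OF u])
  have "(\<lambda>x\<in>carrier M. \<zero>\<^bsub>M\<^esub>) \<in> module_hom A M M"
    using sm sm0 unfolding module_hom_def by auto
  then show ?thesis by (simp add: End_ring_def)
qed

text \<open>A return to \<open>z\<close> yields right multiplication by a cycle. This endomorphism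
  is nonzero, but its image lies in the radical, so it has no inverse, unlike the nonzero elements
  of a field.\<close>

lemma uniserial_End_iso_fieldD:
  assumes "End_iso_field Q I M" and k: "0 < k" "k < w"
  shows "walk Q z k \<noteq> z"
proof
  assume "walk Q z k = z"
  let ?E = "End_ring A M" and ?p = "path_elem (pth Q z k) :: _ \<Rightarrow> 'k"
  obtain \<phi> where \<phi>: "\<phi> \<in> ring_iso ?E (ring_of_type_algebra :: 'k ring)"
    using assms(1) by (auto simp: End_iso_field_def)
  have mult: "\<phi> (\<theta> \<otimes>\<^bsub>?E\<^esub> \<psi>) = \<phi> \<theta> * \<phi> \<psi>" and add: "\<phi> (\<theta> \<oplus>\<^bsub>?E\<^esub> \<psi>) = \<phi> \<theta> + \<phi> \<psi>"
    if "\<theta> \<in> carrier ?E" "\<psi> \<in> carrier ?E" for \<theta> \<psi>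
    using \<phi> that by (auto simp: ring_iso_def ring_hom_def ring_of_type_algebra_def)
  have one: "\<phi> \<one>\<^bsub>?E\<^esub> = 1" and bij: "bij_betw \<phi> (carrier ?E) UNIV"
    using \<phi> by (auto simp: ring_iso_def ring_hom_def ring_of_type_algebra_def)
  have inj: "\<phi> \<theta> = \<phi> \<psi> \<Longrightarrow> \<theta> = \<psi>" if "\<theta> \<in> carrier ?E" "\<psi> \<in> carrier ?E" for \<theta> \<psi>
    using bij that by (auto simp: bij_betw_def dest: inj_onD)
  have p: "?p \<in> carrier KQ" by (rule path_elem_closed[OF uniserial_paths[OF u k(2)]])
  have "\<Phi> (f \<otimes>\<^bsub>KQ\<^esub> ?p) = \<Phi> (g \<otimes>\<^bsub>KQ\<^esub> ?p)"
    if "f \<in> carrier KQ" "g \<in> carrier KQ" "\<Phi> f = \<Phi> g" for f g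
    using that p uniserial_eq_iff[OF u that(1,2)] \<open>walk Q z k = z\<close>
    by (subst uniserial_eq_iff[OF u]) (auto simp: path_algebra_mult_closed mult_path_elem_pth_apply)
  then obtain \<theta>0 where \<theta>0: "\<And>f. f \<in> carrier KQ \<Longrightarrow> \<theta>0 (\<Phi> f) = \<Phi> (f \<otimes>\<^bsub>KQ\<^esub> ?p)"
    using uniserial_map[of \<Phi> "\<lambda>f. \<Phi> (f \<otimes>\<^bsub>KQ\<^esub> ?p)"] by metis
  define \<theta> where "\<theta> = restrict \<theta>0 (carrier M)"
  have \<theta>: "\<theta> (\<Phi> f) = \<Phi> (f \<otimes>\<^bsub>KQ\<^esub> ?p)" if "f \<in> carrier KQ" for f
    using \<theta>0[OF that] that by (simp add: \<theta>_def uniserial_mem)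
  have "\<theta> \<in> module_hom A M M"
    by (rule uniserial_hom[OF u u _ \<open>walk Q z k = z\<close>]) (use \<theta> uniserial_verts in auto)
  then have \<theta>E: "\<theta> \<in> carrier ?E" by (simp add: End_ring_def \<theta>_def)
  have "\<theta> \<noteq> \<zero>\<^bsub>?E\<^esub>"
  proof
    assume "\<theta> = \<zero>\<^bsub>?E\<^esub>"
    then have "\<Phi> ?p = \<Phi> \<zero>\<^bsub>KQ\<^esub>"
      using \<theta>[OF one_closed] KQ_l_one[OF p] by (simp add: End_ring_def uniserial_mem uniserial_zero[OF u])
    then have "?p (pth Q z k) = \<zero>\<^bsub>KQ\<^esub> (pth Q z k)"
      using uniserial_eq_iff[OF u p zero_closed] k by blast
    then show False by (simp add: path_elem_def zero_apply)
  qed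
  moreover have "\<phi> \<zero>\<^bsub>?E\<^esub> = 0"
  proof -
    interpret M: abelian_group M by (rule uniserial_abelian_group[OF u])
    have "\<zero>\<^bsub>?E\<^esub> \<oplus>\<^bsub>?E\<^esub> \<zero>\<^bsub>?E\<^esub> = \<zero>\<^bsub>?E\<^esub>" by (auto simp: End_ring_def)
    then have "\<phi> \<zero>\<^bsub>?E\<^esub> + \<phi> \<zero>\<^bsub>?E\<^esub> = \<phi> \<zero>\<^bsub>?E\<^esub>"
      using add[OF End_ring_zero End_ring_zero] by argo
    then show ?thesis by (simp only: add_cancel_left_right)
  qed
  ultimately have "\<phi> \<theta> \<noteq> 0" using inj[OF \<theta>E End_ring_zero] by auto
  obtain \<psi> where \<psi>: "\<psi> \<in> carrier ?E" "\<phi> \<psi> = inverse (\<phi> \<theta>)"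
    using bij unfolding bij_betw_def by (metis UNIV_I imageE)
  then have "\<phi> (\<theta> \<otimes>\<^bsub>?E\<^esub> \<psi>) = \<phi> \<one>\<^bsub>?E\<^esub>"
    using mult[OF \<theta>E \<psi>(1)] \<open>\<phi> \<theta> \<noteq> 0\<close> by (simp add: one)
  then have "\<theta> \<otimes>\<^bsub>?E\<^esub> \<psi> = \<one>\<^bsub>?E\<^esub>"
    by (rule inj[OF End_ring_comp[OF \<theta>E \<psi>(1)] End_ring_id])
  then have "\<theta> (\<psi> (\<Phi> \<one>\<^bsub>KQ\<^esub>)) = \<Phi> \<one>\<^bsub>KQ\<^esub>"
    by (auto simp: End_ring_def uniserial_mem compose_def dest: fun_cong[of _ _ "\<Phi> \<one>\<^bsub>KQ\<^esub>"])
  moreover obtain f where f: "f \<in> carrier KQ" "\<psi> (\<Phi> \<one>\<^bsub>KQ\<^esub>) = \<Phi> f"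
    using module_homD(1)[OF End_ringD(1)[OF \<psi>(1)] uniserial_mem[OF one_closed]] by (auto simp: uniserial_carrier[OF u])
  ultimately have "\<Phi> (f \<otimes>\<^bsub>KQ\<^esub> ?p) = \<Phi> \<one>\<^bsub>KQ\<^esub>" by (simp add: \<theta>)
  then have "(f \<otimes>\<^bsub>KQ\<^esub> ?p) (pth Q z 0) = \<one>\<^bsub>KQ\<^esub> (pth Q z 0)"
    using uniserial_eq_iff[OF u path_algebra_mult_closed[OF f(1) p] one_closed] w by blast
  then show False
    using k(1) uniserial_verts unfolding mult_path_elem_pth_apply one_pth_apply by simp
qed

text \<open>The image of the generator is fixed by the trivial path at \<open>z\<close>, hence is a
  combination of paths from \<open>z\<close> to \<open>z\<close>. Without a return the only one with
  fewer than \<open>w\<close> arrows is trivial, so every endomorphism is a scalar.\<close>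

lemma uniserial_End_iso_fieldI:
  assumes norep: "\<And>k. 0 < k \<Longrightarrow> k < w \<Longrightarrow> walk Q z k \<noteq> z"
  shows "End_iso_field Q I M"
proof -
  let ?E = "End_ring A M" and ?s = "\<lambda>c p. c * (\<one>\<^bsub>KQ\<^esub> p :: 'k)"
  note s = scale_one_closed
  have uniq: "c = d" if "\<Phi> (?s c) = \<Phi> (?s d)" for c d
  proof -
    have "?s c (pth Q z 0) = ?s d (pth Q z 0)"
      using that uniserial_eq_iff[OF u s s] w by blast
    then show ?thesis using uniserial_verts unfolding one_pth_apply by simp
  qed
  have ex: "\<exists>c. \<theta> (\<Phi> \<one>\<^bsub>KQ\<^esub>) = \<Phi> (?s c)" if \<theta>: "\<theta> \<in> carrier ?E" for \<theta>
  proof -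
    obtain g where g: "g \<in> carrier KQ" "\<theta> (\<Phi> \<one>\<^bsub>KQ\<^esub>) = \<Phi> g"
      using module_homD(1)[OF End_ringD(1)[OF \<theta>] uniserial_mem[OF one_closed]] by (auto simp: uniserial_carrier[OF u])
    have e: "path_elem (pth Q z 0) \<in> carrier KQ"
      by (rule path_elem_closed[OF uniserial_paths[OF u w]])
    have "\<Phi> \<one>\<^bsub>KQ\<^esub> = \<Phi> (path_elem (pth Q z 0))"
      using uniserial_mult_start[OF u one_closed] KQ_l_one[OF e] by simp
    then have "\<Phi> g = \<Phi> (path_elem (pth Q z 0) \<otimes>\<^bsub>KQ\<^esub> g)"
      using End_ring_apply[OF \<theta> g(2,1) e] g(2) by simp
    also have "\<dots> = \<Phi> (?s (g (pth Q z 0)))"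
      using e g(1) norep uniserial_verts by (subst uniserial_eq_iff[OF u])
        (auto simp: path_algebra_mult_closed s path_elem_mult_pth_apply one_pth_apply simp del: pth_0)
    finally show ?thesis using g by auto
  qed
  define \<phi> where "\<phi> \<theta> = (THE c. \<theta> (\<Phi> \<one>\<^bsub>KQ\<^esub>) = \<Phi> (?s c))" for \<theta>
  have \<phi>I: "\<phi> \<theta> = c" if "\<theta> (\<Phi> \<one>\<^bsub>KQ\<^esub>) = \<Phi> (?s c)" for \<theta> c
    unfolding \<phi>_def by (rule the_equality) (use that uniq in auto)
  have \<phi>1: "\<theta> (\<Phi> \<one>\<^bsub>KQ\<^esub>) = \<Phi> (?s (\<phi> \<theta>))" if "\<theta> \<in> carrier ?E" for \<theta>
    using ex[OF that] \<phi>I by metis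
  have \<phi>: "\<theta> (\<Phi> f) = \<Phi> (\<lambda>p. \<phi> \<theta> * f p)" if "\<theta> \<in> carrier ?E" "f \<in> carrier KQ" for \<theta> f
    using End_ring_apply[OF that(1) \<phi>1[OF that(1)] s that(2)] mult_scale_one[OF that(2)] by simp
  have "\<phi> \<in> ring_hom ?E (ring_of_type_algebra :: 'k ring)"
  proof (rule ring_hom_memI)
    fix \<theta> \<psi> assume \<theta>: "\<theta> \<in> carrier ?E" and \<psi>: "\<psi> \<in> carrier ?E"
    have "\<theta> (\<psi> (\<Phi> \<one>\<^bsub>KQ\<^esub>)) = \<Phi> (?s (\<phi> \<theta> * \<phi> \<psi>))"
      using \<phi>1[OF \<psi>] \<phi>[OF \<theta> s] by (simp add: mult.assoc)
    then have "\<phi> (\<theta> \<otimes>\<^bsub>?E\<^esub> \<psi>) = \<phi> \<theta> * \<phi> \<psi>"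
      by (intro \<phi>I) (simp add: End_ring_def compose_def uniserial_mem)
    then show "\<phi> (\<theta> \<otimes>\<^bsub>?E\<^esub> \<psi>) = \<phi> \<theta> \<otimes>\<^bsub>ring_of_type_algebra\<^esub> \<phi> \<psi>"
      by (simp add: ring_of_type_algebra_def)
    have "?s (\<phi> \<theta>) \<oplus>\<^bsub>KQ\<^esub> ?s (\<phi> \<psi>) = ?s (\<phi> \<theta> + \<phi> \<psi>)"
      by (rule ext) (simp add: add_apply algebra_simps)
    then have "\<theta> (\<Phi> \<one>\<^bsub>KQ\<^esub>) \<oplus>\<^bsub>M\<^esub> \<psi> (\<Phi> \<one>\<^bsub>KQ\<^esub>) = \<Phi> (?s (\<phi> \<theta> + \<phi> \<psi>))"
      using \<phi>1[OF \<theta>] \<phi>1[OF \<psi>] uniserial_add[OF u s s, of "\<phi> \<theta>" "\<phi> \<psi>"] by simp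
    then have "\<phi> (\<theta> \<oplus>\<^bsub>?E\<^esub> \<psi>) = \<phi> \<theta> + \<phi> \<psi>"
      by (intro \<phi>I) (simp add: End_ring_def uniserial_mem)
    then show "\<phi> (\<theta> \<oplus>\<^bsub>?E\<^esub> \<psi>) = \<phi> \<theta> \<oplus>\<^bsub>ring_of_type_algebra\<^esub> \<phi> \<psi>"
      by (simp add: ring_of_type_algebra_def)
  next
    have "\<phi> \<one>\<^bsub>?E\<^esub> = 1" by (intro \<phi>I) (simp add: End_ring_def uniserial_mem)
    then show "\<phi> \<one>\<^bsub>?E\<^esub> = \<one>\<^bsub>ring_of_type_algebra\<^esub>" by (simp add: ring_of_type_algebra_def)
  qed (simp add: ring_of_type_algebra_def)
  moreover have "bij_betw \<phi> (carrier ?E) (carrier (ring_of_type_algebra :: 'k ring))"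
  proof (rule bij_betw_imageI)
    show "inj_on \<phi> (carrier ?E)"
    proof (rule inj_onI)
      fix \<theta> \<psi> assume *: "\<theta> \<in> carrier ?E" "\<psi> \<in> carrier ?E" "\<phi> \<theta> = \<phi> \<psi>"
      then show "\<theta> = \<psi>"
        using End_ringD(2) \<phi>[OF *(1)] \<phi>[OF *(2)] by (intro End_ring_eqI) auto
    qed
    have "c \<in> \<phi> ` carrier ?E" for c
    proof -
      define \<theta> where "\<theta> = (\<lambda>x\<in>carrier M. scalar Q I c \<odot>\<^bsub>M\<^esub> x)"
      have ap: "\<theta> (\<Phi> f) = \<Phi> (\<lambda>p. c * f p)" if "f \<in> carrier KQ" for f
        using that uniserial_smult[OF u s that] scale_one_mult[OF that] by (simp add: \<theta>_def uniserial_mem scalar_def)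
      have "\<theta> (\<Phi> f \<oplus>\<^bsub>M\<^esub> \<Phi> g) = \<theta> (\<Phi> f) \<oplus>\<^bsub>M\<^esub> \<theta> (\<Phi> g)"
        if f: "f \<in> carrier KQ" and g: "g \<in> carrier KQ" for f g
      proof -
        have "(\<lambda>p. c * f p) \<oplus>\<^bsub>KQ\<^esub> (\<lambda>p. c * g p) = (\<lambda>p. c * (f \<oplus>\<^bsub>KQ\<^esub> g) p)"
          by (rule ext) (simp add: add_apply algebra_simps)
        then show ?thesis
          unfolding uniserial_add[OF u f g] ap[OF add_closed[OF f g]] ap[OF f] ap[OF g]
            uniserial_add[OF u scale_closed[OF f] scale_closed[OF g]] by simp
      qed
      moreover have "\<theta> (cls Q I f \<odot>\<^bsub>M\<^esub> \<Phi> g) = cls Q I f \<odot>\<^bsub>M\<^esub> \<theta> (\<Phi> g)"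
        if f: "f \<in> carrier KQ" and g: "g \<in> carrier KQ" for f g
        unfolding uniserial_smult[OF u f g] ap[OF path_algebra_mult_closed[OF f g]] ap[OF g]
          uniserial_smult[OF u f scale_closed[OF g]] mult_scale ..
      moreover have "\<theta> (\<Phi> f) \<in> carrier M" if "f \<in> carrier KQ" for f
        unfolding ap[OF that] by (intro uniserial_mem scale_closed that)
      ultimately have "\<theta> \<in> module_hom A M M"
        unfolding module_hom_def uniserial_carrier[OF u] carrier_A by blast
      then have "\<theta> \<in> carrier ?E" by (simp add: End_ring_def \<theta>_def)
      moreover have "\<phi> \<theta> = c" by (rule \<phi>I) (rule ap[OF one_closed])
      ultimately show ?thesis by blast
    qed
    then show "\<phi> ` carrier ?E = carrier (ring_of_type_algebra :: 'k ring)"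
      by (auto simp: ring_of_type_algebra_def)
  qed
  ultimately have "\<phi> \<in> ring_iso ?E (ring_of_type_algebra :: 'k ring)"
    by (simp add: ring_iso_def)
  moreover have "\<phi> (\<lambda>m\<in>carrier M. scalar Q I c \<odot>\<^bsub>M\<^esub> \<theta> m) = c * \<phi> \<theta>" if \<theta>: "\<theta> \<in> carrier ?E" for c \<theta>
  proof (rule \<phi>I)
    have "scalar Q I c \<odot>\<^bsub>M\<^esub> \<theta> (\<Phi> \<one>\<^bsub>KQ\<^esub>) = \<Phi> (?s (c * \<phi> \<theta>))"
      using uniserial_smult[OF u s s, of c "\<phi> \<theta>"] scale_one_mult[OF s, of c "\<phi> \<theta>"] \<phi>1[OF \<theta>]
      by (simp add: scalar_def mult.assoc)
    then show "(\<lambda>m\<in>carrier M. scalar Q I c \<odot>\<^bsub>M\<^esub> \<theta> m) (\<Phi> \<one>\<^bsub>KQ\<^esub>) = \<Phi> (?s (c * \<phi> \<theta>))"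
      by (simp add: uniserial_mem)
  qed
  ultimately show ?thesis unfolding End_iso_field_def by blast
qed

end

end

section \<open>Projective and Weyl modules\<close>

text \<open>For vertices \<open>x\<close>, the paths \<open>pth Q x k\<close> with
  \<open>k < L x\<close> represent a basis of the algebra, and \<open>L x\<close> is the length of
  \<open>P(x)\<close>. This is all the module theory needs to know about the ideal.\<close>

locale nakayama_basis = nakayama Q n I
  for Q n and I :: "(nat list \<Rightarrow> 'k::field) set" +
  fixes L :: "nat \<Rightarrow> nat"
  assumes mem_I_iff: "f \<in> carrier (path_algebra Q) \<Longrightarrow> f \<in> I \<longleftrightarrow> (\<forall>x k. k < L x \<longrightarrow> f (pth Q x k) = 0)"
    and L_pos: "x \<in> verts Q \<Longrightarrow> 0 < L x"
    and L_paths: "x \<in> verts Q \<Longrightarrow> k < L x \<Longrightarrow> pth Q x k \<in> paths Q"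
    and mem_arrow_ideal_iff: "f \<in> (arrow_ideal Q :: (nat list \<Rightarrow> 'k) set) \<longleftrightarrow>
      f \<in> carrier (path_algebra Q) \<and> (\<forall>x. f [x] = 0)"
begin

lemma cls_eq_iff:
  assumes f: "f \<in> carrier KQ" and g: "g \<in> carrier KQ"
  shows "cls Q I f = cls Q I g \<longleftrightarrow> (\<forall>x k. k < L x \<longrightarrow> f (pth Q x k) = g (pth Q x k))"
proof -
  have g': "(\<lambda>p. -1 * g p) \<in> carrier KQ" by (rule scale_closed) (rule g)
  have "\<ominus>\<^bsub>KQ\<^esub> g = (\<lambda>p. -1 * g p)"
    by (rule I.minus_equality) (use g g' in \<open>auto simp: path_algebra_def\<close>)
  then have "f \<ominus>\<^bsub>KQ\<^esub> g = f \<oplus>\<^bsub>KQ\<^esub> (\<lambda>p. -1 * g p)" by (simp add: a_minus_def)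
  then show ?thesis
    using I.quotient_eq_iff_same_a_r_cos[OF ideal_I f g] mem_I_iff[OF add_closed[OF f g']]
    by (simp add: add_apply)
qed

lemma uniserial_proj:
  assumes x: "x \<in> verts Q"
  shows "uniserial (proj_module Q I x) x (L x) (\<lambda>f. cls Q I (f \<otimes>\<^bsub>KQ\<^esub> path_elem [x]))"
proof -
  have e: "path_elem [x] \<in> carrier KQ"
    using x by (intro path_elem_closed) (simp add: paths_def)
  note cl = path_algebra_mult_closed[OF _ e]
  show ?thesis
  proof (rule uniserialI)
    show "carrier (proj_module Q I x) = (\<lambda>f. cls Q I (f \<otimes>\<^bsub>KQ\<^esub> path_elem [x])) ` carrier KQ"
      using cls_mult[OF _ e] by (auto simp: proj_module_def carrier_A image_iff)
    show "\<zero>\<^bsub>proj_module Q I x\<^esub> = cls Q I (\<zero>\<^bsub>KQ\<^esub> \<otimes>\<^bsub>KQ\<^esub> path_elem [x])"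
      unfolding KQ_l_null[OF e] using I.a_rcos_zero[OF ideal_I additive_subgroup.zero_closed[OF ideal.axioms(1)[OF ideal_I]]] by (simp add: proj_module_def FactRing_def)
  next
    fix f g assume f: "f \<in> carrier KQ" and g: "g \<in> carrier KQ"
    show "cls Q I (f \<otimes>\<^bsub>KQ\<^esub> path_elem [x]) \<oplus>\<^bsub>proj_module Q I x\<^esub> cls Q I (g \<otimes>\<^bsub>KQ\<^esub> path_elem [x]) =
        cls Q I ((f \<oplus>\<^bsub>KQ\<^esub> g) \<otimes>\<^bsub>KQ\<^esub> path_elem [x])"
      using cls_add[OF cl[OF f] cl[OF g]] by (simp add: proj_module_def mult_l_distr)
    show "cls Q I f \<odot>\<^bsub>proj_module Q I x\<^esub> cls Q I (g \<otimes>\<^bsub>KQ\<^esub> path_elem [x]) =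
        cls Q I ((f \<otimes>\<^bsub>KQ\<^esub> g) \<otimes>\<^bsub>KQ\<^esub> path_elem [x])"
      using cls_mult[OF f cl[OF g]] by (simp add: proj_module_def path_algebra_mult_assoc)
    show "cls Q I (f \<otimes>\<^bsub>KQ\<^esub> path_elem [x]) = cls Q I (g \<otimes>\<^bsub>KQ\<^esub> path_elem [x]) \<longleftrightarrow>
        (\<forall>k<L x. f (pth Q x k) = g (pth Q x k))"
      using mult_path_elem_pth_apply[of Q f x 0] mult_path_elem_pth_apply[of Q g x 0]
      by (auto simp: cls_eq_iff[OF cl[OF f] cl[OF g]])
  qed (rule L_paths[OF x])
qed

text \<open>Elements of the arrow ideal vanish at every trivial path, those of
  \<open>vanish x 1\<close> only at \<open>[x]\<close>. Both give the same submodule, as right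
  multiplication by the trivial path at \<open>x\<close> forgets all paths that start
  elsewhere.\<close>

lemma uniserial_simple_at:
  assumes x: "x \<in> verts Q"
  shows "\<exists>\<Psi>. uniserial (simple_at Q I x) x 1 \<Psi>"
proof -
  let ?\<Phi> = "\<lambda>f. cls Q I (f \<otimes>\<^bsub>KQ\<^esub> path_elem [x])"
  note u = uniserial_proj[OF x]
  have e: "path_elem [x] \<in> carrier KQ"
    using x by (intro path_elem_closed) (simp add: paths_def)
  have "{cls Q I j \<otimes>\<^bsub>A\<^esub> cls Q I (path_elem [x]) |j. j \<in> arrow_ideal Q} = ?\<Phi> ` arrow_ideal Q"
    using cls_mult[OF _ e] by (fastforce simp: mem_arrow_ideal_iff image_iff)
  also have "\<dots> = ?\<Phi> ` vanish x 1"
  proof (intro equalityI subsetI)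
    fix y assume "y \<in> ?\<Phi> ` vanish x 1"
    then obtain f where f: "f \<in> carrier KQ" "f [x] = 0" "y = ?\<Phi> f" by (auto simp: vanish_def)
    define g where "g p = (if length p \<le> 1 then 0 else f p)" for p
    have "finite {p. g p \<noteq> 0}"
      by (rule finite_subset[of _ "{p. f p \<noteq> 0}"]) (use f in \<open>auto simp: g_def mem_path_algebra\<close>)
    then have g: "g \<in> carrier KQ" using f by (auto simp: g_def mem_path_algebra)
    have "g (pth Q x k) = f (pth Q x k)" for k
      using f by (cases k) (auto simp: g_def)
    then have "?\<Phi> g = ?\<Phi> f"
      using f g by (subst uniserial_eq_iff[OF u]) auto
    moreover have "g \<in> arrow_ideal Q" using g by (simp add: mem_arrow_ideal_iff g_def)
    ultimately show "y \<in> ?\<Phi> ` arrow_ideal Q" using f by (metis image_eqI)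
  qed (auto simp: vanish_def mem_arrow_ideal_iff)
  finally show ?thesis
    using uniserial_quotient[OF u, of 1] L_pos[OF x] unfolding simple_at_def by auto
qed

text \<open>A path in the ideal stays there when it is prolonged backwards by
  \<open>pth Q x j\<close>. For \<open>j = 1\<close> this is the inequality between neighbouring
  entries of a Kupisch series.\<close>

lemma L_le:
  assumes x: "x \<in> verts Q" and j: "walk Q x j \<in> verts Q"
  shows "L x \<le> j + L (walk Q x j)"
proof (rule ccontr)
  let ?m = "L (walk Q x j)"
  assume "\<not> L x \<le> j + ?m"
  then have p: "pth Q x (j + ?m) \<in> paths Q" and lt: "j + ?m < L x" by (auto intro: L_paths[OF x])
  then have y: "pth Q (walk Q x j) ?m \<in> paths Q" using pth_walk_paths[OF p, of j] by simp
  have px: "pth Q x j \<in> paths Q" using pth_paths_le[OF p] by simp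
  have "path_elem (pth Q (walk Q x j) ?m) \<in> I"
    using mem_I_iff[OF path_elem_closed[OF y]] by (auto simp: path_elem_def)
  then have "path_elem (pth Q (walk Q x j) ?m) \<otimes>\<^bsub>KQ\<^esub> path_elem (pth Q x j) \<in> I"
    by (rule I.I_r_closed[OF _ path_elem_closed[OF px]])
  then have "path_elem (pth Q x (j + ?m)) \<in> I"
    using path_elem_mult[of "pth Q x j" "pth Q (walk Q x j) ?m" Q, where 'k='k] by (simp add: pth_append)
  then have "path_elem (pth Q x (j + ?m)) (pth Q x (j + ?m)) = (0 :: 'k)"
    using mem_I_iff[OF path_elem_closed[OF p]] lt by blast
  then show False by (simp add: path_elem_def)
qed

end

section \<open>Weyl modules and good filtrations for a total ordering\<close>

locale nakayama_ordered = nakayama_basis Q n I L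
  for Q n and I :: "(nat list \<Rightarrow> 'k::field) set" and L +
  fixes r :: "(nat \<times> nat) set"
  assumes r: "linear_order_on (verts Q) r"
begin

lemma r_trans: "(x, y) \<in> r \<Longrightarrow> (y, z) \<in> r \<Longrightarrow> (x, z) \<in> r"
  and r_antisym: "(x, y) \<in> r \<Longrightarrow> (y, x) \<in> r \<Longrightarrow> x = y"
  and r_total: "x \<in> verts Q \<Longrightarrow> y \<in> verts Q \<Longrightarrow> (x, y) \<in> r \<or> (y, x) \<in> r"
  and r_verts: "(x, y) \<in> r \<Longrightarrow> x \<in> verts Q"
  using r unfolding linear_order_on_def partial_order_on_def preorder_on_def refl_on_def total_on_def
  by (auto dest: transD antisymD) (cases "x = y"; auto)

lemma r_refl: "x \<in> verts Q \<Longrightarrow> (x, x) \<in> r"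
  using r_total by blast

text \<open>This is the length of the Weyl module at \<open>x\<close>; the bound \<open>L x\<close>
  takes effect when no larger vertex occurs before the end of \<open>P(x)\<close>.\<close>

definition width :: "nat \<Rightarrow> nat" where
  "width x = (LEAST i. L x \<le> i \<or> (walk Q x i, x) \<notin> r)"

lemma width_le: "width x \<le> L x"
  unfolding width_def by (rule Least_le) simp

lemma width_below: "k < width x \<Longrightarrow> (walk Q x k, x) \<in> r"
  unfolding width_def using not_less_Least by blast

lemma width_end: "width x < L x \<Longrightarrow> (walk Q x (width x), x) \<notin> r"
  using LeastI[of "\<lambda>i. L x \<le> i \<or> (walk Q x i, x) \<notin> r" "L x"] unfolding width_def by auto

lemma le_width_iff: "i \<le> L x \<Longrightarrow> i \<le> width x \<longleftrightarrow> (\<forall>k<i. (walk Q x k, x) \<in> r)"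
  using width_below[of _ x] width_end[of x] by (metis less_le_trans not_le)

lemma width_pos: "x \<in> verts Q \<Longrightarrow> 0 < width x"
  using le_width_iff[of 1 x] L_pos[of x] r_refl[of x] by simp

text \<open>The possible kernels form a chain, and the factor by the \<open>i\<close>-th one has its
  composition factors at the positions below \<open>i\<close>. The least admissible kernel thus
  belongs to the largest \<open>i\<close> with all these vertices below \<open>x\<close>.\<close>

lemma weyl_kernel_eq:
  assumes x: "x \<in> verts Q"
  shows "weyl_kernel Q I r x = (\<lambda>f. cls Q I (f \<otimes>\<^bsub>KQ\<^esub> path_elem [x])) ` vanish x (width x)"
proof -
  let ?\<Phi> = "\<lambda>f. cls Q I (f \<otimes>\<^bsub>KQ\<^esub> path_elem [x])"
  define \<Phi> where "\<Phi> = ?\<Phi>"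
  have u: "uniserial (proj_module Q I x) x (L x) \<Phi>" unfolding \<Phi>_def by (rule uniserial_proj[OF x])
  let ?P = "\<lambda>N. submodule N A (proj_module Q I x) \<and>
    (\<forall>y. composition_factor Q I (quot_module (proj_module Q I x) N) y \<longrightarrow> (y, x) \<in> r)"
  have iff: "?P (\<Phi> ` vanish x i) \<longleftrightarrow> i \<le> width x" if i: "i \<le> L x" for i
    using uniserial_submodule[OF u i] uniserial_composition_factor_iff[OF uniserial_quotient[OF u i] uniserial_simple_at]
      le_width_iff[OF i] by auto
  have P: "?P (\<Phi> ` vanish x (width x))" using iff[OF width_le] by simp
  have least: "\<Phi> ` vanish x (width x) \<subseteq> N" if N: "?P N" for N
  proof -
    obtain i where i: "i \<le> L x" "N = \<Phi> ` vanish x i"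
      using uniserial_submodule_cases[OF u, of N] N by blast
    then have "i \<le> width x" using iff[OF i(1)] N by simp
    then show ?thesis unfolding i(2) by (rule uniserial_vanish_mono[OF u])
  qed
  show ?thesis
    unfolding weyl_kernel_def Let_def \<Phi>_def[symmetric]
    by (rule the_equality) (use P least in \<open>auto intro!: subset_antisym\<close>)
qed

lemma uniserial_weyl:
  assumes x: "x \<in> verts Q"
  shows "\<exists>\<Psi>. uniserial (weyl_module Q I r x) x (width x) \<Psi>"
  using uniserial_quotient[OF uniserial_proj[OF x] width_le[of x]]
  unfolding weyl_module_def weyl_kernel_eq[OF x] by blast

lemma weyl_End_iff:
  assumes x: "x \<in> verts Q"
  shows "End_iso_field Q I (weyl_module Q I r x) \<longleftrightarrow> (\<forall>k. 0 < k \<and> k < width x \<longrightarrow> walk Q x k \<noteq> x)"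
proof -
  obtain \<Psi> where u: "uniserial (weyl_module Q I r x) x (width x) \<Psi>" using uniserial_weyl[OF x] by blast
  show ?thesis
    using uniserial_End_iso_fieldI[OF u width_pos[OF x]] uniserial_End_iso_fieldD[OF u width_pos[OF x]] by blast
qed

text \<open>A good filtration is a tiling of the positions below \<open>L x\<close> by intervals
  whose lengths are the widths of their first vertices. The steps are strict because Weyl modules
  are nonzero.\<close>

lemma good_proj_iff:
  assumes x: "x \<in> verts Q"
  shows "good_module Q I r (proj_module Q I x) \<longleftrightarrow>
    (\<exists>t a. a 0 = L x \<and> a t = 0 \<and>
      (\<forall>k<t. a (Suc k) < a k \<and> a k \<le> L x \<and> a k = a (Suc k) + width (walk Q x (a (Suc k)))))"
    (is "_ \<longleftrightarrow> (\<exists>t a. ?P t a)")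
proof
  obtain \<Phi> where u: "uniserial (proj_module Q I x) x (L x) \<Phi>" using uniserial_proj[OF x] by blast
  {
    assume "good_module Q I r (proj_module Q I x)"
    then obtain t F where F: "filtration A (proj_module Q I x) t F"
      and iso: "\<And>i. i < t \<Longrightarrow> \<exists>y\<in>verts Q. module_iso A (layer (proj_module Q I x) F i) (weyl_module Q I r y)"
      unfolding good_module_def by blast
    obtain a where a: "\<And>k. k \<le> t \<Longrightarrow> a k \<le> L x" "a 0 = L x" "a t = 0" "\<And>k. k < t \<Longrightarrow> a (Suc k) \<le> a k"
      and lay: "\<And>k. k < t \<Longrightarrow> \<exists>\<Psi>. uniserial (layer (proj_module Q I x) F k) (walk Q x (a (Suc k))) (a k - a (Suc k)) \<Psi>"
      using uniserial_filtrationE[OF u F] by blast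
    have "a (Suc k) < a k \<and> a k \<le> L x \<and> a k = a (Suc k) + width (walk Q x (a (Suc k)))" if k: "k < t" for k
    proof -
      obtain \<Psi> where \<Psi>: "uniserial (layer (proj_module Q I x) F k) (walk Q x (a (Suc k))) (a k - a (Suc k)) \<Psi>"
        using lay[OF k] by blast
      obtain y where y: "y \<in> verts Q" and i: "module_iso A (layer (proj_module Q I x) F k) (weyl_module Q I r y)"
        using iso[OF k] by blast
      obtain \<Psi>' where \<Psi>': "uniserial (weyl_module Q I r y) y (width y) \<Psi>'" using uniserial_weyl[OF y] by blast
      have "a k - a (Suc k) > 0" by (rule uniserial_iso_pos[OF \<Psi> \<Psi>' i width_pos[OF y]])
      moreover from uniserial_iso_unique[OF \<Psi> \<Psi>' i this]
      have "walk Q x (a (Suc k)) = y" "a k - a (Suc k) = width y" by auto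
      ultimately show ?thesis
        using a(1)[of k] k by auto
    qed
    then show "\<exists>t a. ?P t a" using a by blast
  }
  assume "\<exists>t a. ?P t a"
  then obtain t a where P: "?P t a" by blast
  let ?F = "\<lambda>k. \<Phi> ` vanish x (a k)"
  have le: "a (Suc k) \<le> a k" if "k < t" for k using P that by auto
  have F: "filtration A (proj_module Q I x) t ?F"
    by (rule uniserial_filtrationI(1)[OF u]) (use P le in auto)
  have "\<exists>y\<in>verts Q. module_iso A (layer (proj_module Q I x) ?F i) (weyl_module Q I r y)" if i: "i < t" for i
  proof
    let ?y = "walk Q x (a (Suc i))"
    have "\<exists>\<Psi>. uniserial (layer (proj_module Q I x) ?F i) ?y (a i - a (Suc i)) \<Psi>"
      by (rule uniserial_filtrationI(2)[OF u]) (use P le i in auto)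
    moreover have "a i - a (Suc i) = width ?y" using P i by (metis diff_add_inverse)
    ultimately obtain \<Psi> where \<Psi>: "uniserial (layer (proj_module Q I x) ?F i) ?y (width ?y) \<Psi>" by auto
    have "a (Suc i) < L x" using P i by (meson less_le_trans)
    then show y: "?y \<in> verts Q" using L_paths[OF x] by (simp add: pth_in_paths_iff)
    obtain \<Psi>' where "uniserial (weyl_module Q I r ?y) ?y (width ?y) \<Psi>'" using uniserial_weyl[OF y] by blast
    then show "module_iso A (layer (proj_module Q I x) ?F i) (weyl_module Q I r ?y)"
      by (rule uniserial_isoI[OF \<Psi>])
  qed
  then show "good_module Q I r (proj_module Q I x)"
    unfolding good_module_def using F by blast
qed

end

section \<open>Relations with interior maximum\<close>

text \<open>\<open>generatorD\<close> says that a generator is the first zero path from its start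
  and that no proper final segment of it is zero. \<open>ex_generator\<close> says that where
  \<open>P(x)\<close> is cut off inside the quiver, a final segment of the first zero path from
  \<open>x\<close> is a generator.\<close>

locale nakayama_generators = nakayama_ordered Q n I L r
  for Q n and I :: "(nat list \<Rightarrow> 'k::field) set" and L r +
  fixes G :: "nat list set"
  assumes generatorD: "g \<in> G \<Longrightarrow> \<exists>x\<in>verts Q. g = pth Q x (L x) \<and> g \<in> paths Q \<and>
      (\<forall>j. 0 < j \<longrightarrow> j \<le> L x \<longrightarrow> L x < j + L (walk Q x j))"
    and ex_generator: "pth Q x (L x) \<in> paths Q \<Longrightarrow> \<exists>j\<le>L x. pth Q (walk Q x j) (L x - j) \<in> G"
begin

lemma max_wrt_eqI:
  assumes "m \<in># V" "\<And>y. y \<in># V \<Longrightarrow> (y, m) \<in> r"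
  shows "max_wrt r V = m"
  unfolding max_wrt_def by (rule the_equality) (use assms r_antisym in blast)+

lemma max_wrt_Hod_pth:
  assumes "s \<le> l" "walk Q x s = m" "\<And>i. i \<le> l \<Longrightarrow> (walk Q x i, m) \<in> r"
  shows "max_wrt r (Hod (pth Q x l)) = m"
  by (rule max_wrt_eqI) (use assms in \<open>auto simp: Hod_def set_pth\<close>)

lemma ex_max_walk:
  assumes "pth Q x l \<in> paths Q"
  shows "\<exists>s\<le>l. \<forall>i\<le>l. (walk Q x i, walk Q x s) \<in> r"
  using assms
proof (induction l)
  case 0
  then have "x \<in> verts Q" by (simp only: pth_in_paths_iff)
  then show ?case using r_refl by auto
next
  case (Suc l)
  then obtain s where s: "s \<le> l" "\<And>i. i \<le> l \<Longrightarrow> (walk Q x i, walk Q x s) \<in> r"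
    using pth_paths_le[of x "Suc l" l] by auto
  have "walk Q x (Suc l) \<in> verts Q" "walk Q x s \<in> verts Q"
    using Suc.prems pth_paths_le[of x "Suc l" s] s by (auto simp: pth_in_paths_iff)
  then consider "(walk Q x (Suc l), walk Q x s) \<in> r" | "(walk Q x s, walk Q x (Suc l)) \<in> r"
    using r_total by blast
  then show ?case
  proof cases
    case 1
    then show ?thesis using s by (intro exI[of _ s]) (auto simp: le_Suc_eq)
  next
    case 2
    then show ?thesis
      using s r_trans[OF _ 2] r_refl[OF \<open>walk Q x (Suc l) \<in> verts Q\<close>]
      by (intro exI[of _ "Suc l"]) (auto simp: le_Suc_eq)
  qed
qed

text \<open>A vertex that recurs in its Weyl module dominates a whole period, hence every vertex, and it
  lies in the interior of the relation that bounds the projective module.\<close>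

lemma no_return:
  assumes cond: "\<forall>g\<in>G. max_wrt r (Hod g) \<notin># Interior g" and x: "x \<in> verts Q" and s: "0 < s" "s < width x"
  shows "walk Q x s \<noteq> x"
proof
  assume ret: "walk Q x s = x"
  have period: "walk Q x (s + k) = walk Q x k" for k
    by (subst walk_walk[symmetric]) (simp add: ret)
  have dom: "(walk Q x k, x) \<in> r" for k
  proof (induction k rule: less_induct)
    case (less k)
    show ?case
    proof (cases "k < s")
      case True
      then show ?thesis using width_below s by simp
    next
      case False
      then show ?thesis using less[of "k - s"] period[of "k - s"] s by simp
    qed
  qed
  then have oL: "s < L x" using width_end width_le[of x] s by force
  have "walk Q x (L x) \<in> verts Q" using dom r_verts by blast
  then have "pth Q x (L x) \<in> paths Q" using x by (simp add: pth_in_paths_iff)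
  then obtain j where j: "j \<le> L x" and G: "pth Q (walk Q x j) (L x - j) \<in> G"
    using ex_generator by blast
  have Lj: "L (walk Q x j) = L x - j" using generatorD[OF G] by auto
  \<comment> \<open>Otherwise the same vertex occurs at the earlier position \<open>j - s\<close>,
    and the relation starting there would already cut \<open>P(x)\<close> off at
    \<open>L x - s\<close>.\<close>
  have "j < s"
  proof (rule ccontr)
    assume "\<not> j < s"
    then have "walk Q x (j - s) = walk Q x j" using period[of "j - s"] by simp
    moreover have "walk Q x (j - s) \<in> verts Q" using dom r_verts by blast
    ultimately have "L x \<le> (j - s) + (L x - j)" using L_le[OF x, of "j - s"] Lj by simp
    then show False using \<open>\<not> j < s\<close> j s oL by simp
  qed
  have "x \<in># Interior (pth Q (walk Q x j) (L x - j))"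
    unfolding Interior_pth using \<open>j < s\<close> oL ret by (intro exI[of _ "s - j"]) auto
  moreover have "max_wrt r (Hod (pth Q (walk Q x j) (L x - j))) = x"
    using \<open>j < s\<close> oL ret dom by (intro max_wrt_Hod_pth[of "s - j"]) auto
  ultimately show False using cond G by force
qed

text \<open>Here the condition on relations secures the filtration: a Weyl module that is too long
  makes its top \<open>walk Q x s\<close> the maximum of the relation ending at position
  \<open>L x\<close>, and an interior vertex of it.\<close>

lemma width_le_rest:
  assumes cond: "\<forall>g\<in>G. max_wrt r (Hod g) \<notin># Interior g" and x: "x \<in> verts Q" and s: "s < L x"
    and rec: "\<And>k. k < s \<Longrightarrow> (walk Q x k, walk Q x s) \<in> r"
  shows "width (walk Q x s) \<le> L x - s"
proof (rule ccontr)
  let ?y = "walk Q x s"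
  assume "\<not> width ?y \<le> L x - s"
  then have m: "L x - s < width ?y" by simp
  have y: "?y \<in> verts Q" using L_paths[OF x s] by (simp add: pth_in_paths_iff)
  have dom: "(walk Q x k, ?y) \<in> r" if "k \<le> L x" for k
  proof (cases "k < s")
    case False
    then show ?thesis using width_below[of "k - s" ?y] m that by simp
  qed (rule rec)
  \<comment> \<open>Only vertices are related by \<open>r\<close>, so the walk has not run off a
    linear quiver and a relation must end here.\<close>
  have "walk Q x (L x) \<in> verts Q" using dom r_verts by blast
  then have "pth Q x (L x) \<in> paths Q" using x by (simp add: pth_in_paths_iff)
  then obtain j where j: "j \<le> L x" and G: "pth Q (walk Q x j) (L x - j) \<in> G"
    using ex_generator by blast
  have Lj: "L (walk Q x j) = L x - j" using generatorD[OF G] by auto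
  \<comment> \<open>A relation starting at or after position \<open>s\<close> would bound
    \<open>L ?y\<close> by \<open>L x - s\<close>, which is less than
    \<open>width ?y\<close>.\<close>
  have "j < s"
  proof (rule ccontr)
    assume "\<not> j < s"
    moreover have "walk Q x j \<in> verts Q" using dom[OF j] r_verts by blast
    ultimately have "L ?y \<le> (j - s) + (L x - j)" using L_le[OF y, of "j - s"] Lj by simp
    then show False using \<open>\<not> j < s\<close> j m width_le[of ?y] by simp
  qed
  have "?y \<in># Interior (pth Q (walk Q x j) (L x - j))"
    unfolding Interior_pth using \<open>j < s\<close> s by (intro exI[of _ "s - j"]) auto
  moreover have "max_wrt r (Hod (pth Q (walk Q x j) (L x - j))) = ?y"
    using \<open>j < s\<close> s dom by (intro max_wrt_Hod_pth[of "s - j"]) auto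
  ultimately show False using cond G by force
qed

text \<open>The tops of the Weyl modules in the filtration of \<open>P(x)\<close> are the successive records of the
  walk from \<open>x\<close>.\<close>

lemma ex_good_sequence:
  assumes cond: "\<forall>g\<in>G. max_wrt r (Hod g) \<notin># Interior g" and x: "x \<in> verts Q" and "s \<le> L x"
    and "s < L x \<Longrightarrow> (\<And>k. k < s \<Longrightarrow> (walk Q x k, walk Q x s) \<in> r)"
  shows "\<exists>t a. a 0 = L x \<and> a t = s \<and>
      (\<forall>k<t. a (Suc k) < a k \<and> a k \<le> L x \<and> a k = a (Suc k) + width (walk Q x (a (Suc k))))"
  using assms(3,4)
\<comment> \<open>The part from position \<open>s\<close> on is tiled, so the sequence ends in
  \<open>s\<close>. At \<open>s = L x\<close> the walk may have left the quiver, hence the record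
  property is demanded only before.\<close>
proof (induction "L x - s" arbitrary: s rule: less_induct)
  case less
  show ?case
  proof (cases "s = L x")
    case True
    then show ?thesis by (intro exI[of _ 0] exI[of _ "\<lambda>_. L x"]) simp
  next
    case False
    then have s: "s < L x" using less.prems by simp
    let ?y = "walk Q x s"
    define s' where "s' = s + width ?y"
    have y: "?y \<in> verts Q" using L_paths[OF x s] by (simp add: pth_in_paths_iff)
    have w: "width ?y \<le> L x - s" using width_le_rest[OF cond x s] less.prems(2)[OF s] by blast
    have s': "s < s'" "s' \<le> L x" using w width_pos[OF y] s by (auto simp: s'_def)
    have rec': "(walk Q x k, walk Q x s') \<in> r" if "s' < L x" "k < s'" for k
    proof -
      \<comment> \<open>\<open>P(?y)\<close> reaches at least to the end of \<open>P(x)\<close>, so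
        a Weyl module ending earlier is stopped by a larger vertex, which is the next
        record.\<close>
      have "width ?y < L ?y" using L_le[OF x y] that by (simp add: s'_def)
      then have "(walk Q x s', ?y) \<notin> r" using width_end[of ?y] by (simp add: s'_def)
      moreover have "walk Q x s' \<in> verts Q" using L_paths[OF x that(1)] by (simp add: pth_in_paths_iff)
      ultimately have 1: "(?y, walk Q x s') \<in> r" using r_total y by blast
      have "(walk Q x k, ?y) \<in> r"
      proof (cases "k < s")
        case True
        then show ?thesis by (rule less.prems(2)[OF s])
      next
        case False
        then show ?thesis using width_below[of "k - s" ?y] that by (simp add: s'_def)
      qed
      then show ?thesis using 1 r_trans by blast
    qed
    obtain t a where a: "a 0 = L x" "a t = s'"
      "\<And>k. k < t \<Longrightarrow> a (Suc k) < a k \<and> a k \<le> L x \<and> a k = a (Suc k) + width (walk Q x (a (Suc k)))"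
      using less.hyps[of s', OF _ s'(2) rec'] s s' by (auto simp: diff_less_mono2)
    let ?a = "a(Suc t := s)"
    have "?a (Suc k) < ?a k \<and> ?a k \<le> L x \<and> ?a k = ?a (Suc k) + width (walk Q x (?a (Suc k)))"
      if "k < Suc t" for k
    proof (cases "k = t")
      case True
      then show ?thesis using a(2) s' by (simp add: s'_def)
    next
      case False
      then show ?thesis using a(3)[of k] that by simp
    qed
    moreover have "?a 0 = L x" "?a (Suc t) = s" using a(1) by auto
    ultimately show ?thesis by blast
  qed
qed

text \<open>If the maximum of a relation \<open>g\<close> from \<open>x\<close> is interior, then either it equals \<open>x\<close> and recurs
  in the Weyl module at \<open>x\<close>, or its first occurrence is the top of the last Weyl module in
  \<open>P(x)\<close>, which reaches at least to the end of \<open>g\<close> and so is too long.\<close>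

lemma q_ordering_generator:
  assumes q: "q_ordering Q I r" and g: "g \<in> G"
  shows "max_wrt r (Hod g) \<notin># Interior g"
proof
  obtain x where x: "x \<in> verts Q" and gx: "g = pth Q x (L x)" and gp: "pth Q x (L x) \<in> paths Q"
    and suffix: "\<And>j. 0 < j \<Longrightarrow> j \<le> L x \<Longrightarrow> L x < j + L (walk Q x j)"
    using generatorD[OF g] by blast
  obtain i0 where i0: "i0 \<le> L x" and dom1: "\<And>i. i \<le> L x \<Longrightarrow> (walk Q x i, walk Q x i0) \<in> r"
    using ex_max_walk[OF gp] by blast
  define m where "m = walk Q x i0"
  have max: "max_wrt r (Hod g) = m"
    unfolding gx m_def by (rule max_wrt_Hod_pth[OF i0 refl dom1])
  have dom: "(walk Q x i, m) \<in> r" if "i \<le> L x" for i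
    using dom1[OF that] by (simp add: m_def)
  assume "max_wrt r (Hod g) \<in># Interior g"
  then obtain j where j: "0 < j" "j < L x" "walk Q x j = m"
    unfolding max unfolding gx Interior_pth by blast
  show False
  proof (cases "m = x")
    case True
    \<comment> \<open>Every vertex of \<open>g\<close> lies below \<open>x\<close>, so the Weyl
      module at \<open>x\<close> is all of \<open>P(x)\<close>.\<close>
    then have "j < width x"
      using width_end[of x] dom[of "width x"] width_le[of x] j by force
    moreover have "End_iso_field Q I (weyl_module Q I r x)" using q x by (simp add: q_ordering_def)
    ultimately show False using weyl_End_iff[OF x] j True by blast
  next
    case False
    define s where "s = (LEAST i. walk Q x i = m)"
    have s: "walk Q x s = m"
      unfolding s_def by (rule LeastI[of _ j]) (rule j)
    have least: "s \<le> i" if "walk Q x i = m" for i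
      unfolding s_def using that by (rule Least_le)
    have "s \<le> j" by (rule least) (rule j)
    have "s > 0" using False s by (cases s) auto
    have "good_module Q I r (proj_module Q I x)" using q x by (simp add: q_ordering_def)
    then obtain t a where a: "a 0 = L x" "a t = 0"
      "\<And>k. k < t \<Longrightarrow> a k \<le> L x \<and> a k = a (Suc k) + width (walk Q x (a (Suc k)))"
      unfolding good_proj_iff[OF x] by blast
    \<comment> \<open>The layer before index \<open>i\<close> covers position \<open>s\<close>. Its
      top dominates \<open>m\<close> as a Weyl module requires, and is dominated by \<open>m\<close>
      as a vertex of \<open>g\<close>, so it equals \<open>m\<close>; the choice of \<open>s\<close>
      as first occurrence then places it at \<open>s\<close>.\<close>
    define i where "i = (LEAST i. a i \<le> s)"
    have "a i \<le> s" unfolding i_def by (rule LeastI[of _ t]) (simp add: a)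
    have "i \<le> t" unfolding i_def by (rule Least_le) (simp add: a)
    have "i \<noteq> 0" using \<open>a i \<le> s\<close> a(1) \<open>s \<le> j\<close> j(2) by (cases i) auto
    then obtain k where k: "i = Suc k" by (cases i) auto
    then have "s < a k" using not_less_Least[of k "\<lambda>i. a i \<le> s"] unfolding i_def by simp
    have ak: "a k \<le> L x" "a k = a i + width (walk Q x (a i))"
      using a(3)[of k] \<open>i \<le> t\<close> k by auto
    have "(m, walk Q x (a i)) \<in> r"
      using width_below[of "s - a i" "walk Q x (a i)"] \<open>a i \<le> s\<close> \<open>s < a k\<close> ak s by simp
    moreover have "(walk Q x (a i), m) \<in> r" using dom \<open>a i \<le> s\<close> \<open>s \<le> j\<close> j(2) by simp
    ultimately have "walk Q x (a i) = m" using r_antisym by blast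
    then have ai: "a i = s" using least \<open>a i \<le> s\<close> by (simp add: le_antisym)
    \<comment> \<open>No proper final segment of \<open>g\<close> is zero, so \<open>P(m)\<close> is
      longer than what remains of \<open>P(x)\<close>. The Weyl module is therefore stopped by a
      larger vertex at \<open>a k\<close>, but \<open>a k \<le> L x\<close> is still a position of
      \<open>g\<close>.\<close>
    have "width m < L m"
      using suffix[OF \<open>s > 0\<close>] ak ai s \<open>s \<le> j\<close> j(2) by auto
    then have "(walk Q m (width m), m) \<notin> r" by (rule width_end)
    moreover have "walk Q m (width m) = walk Q x (a k)"
      using ak ai s walk_walk[of Q x s "width m"] by simp
    ultimately show False using dom[OF ak(1)] by simp
  qed
qed

theorem q_ordering_iff: "q_ordering Q I r \<longleftrightarrow> (\<forall>g\<in>G. max_wrt r (Hod g) \<notin># Interior g)"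
proof
  assume "q_ordering Q I r"
  then show "\<forall>g\<in>G. max_wrt r (Hod g) \<notin># Interior g" using q_ordering_generator by blast
next
  assume cond: "\<forall>g\<in>G. max_wrt r (Hod g) \<notin># Interior g"
  show "q_ordering Q I r"
    unfolding q_ordering_def
  proof (intro ballI conjI)
    fix x assume x: "x \<in> verts Q"
    show "End_iso_field Q I (weyl_module Q I r x)"
      unfolding weyl_End_iff[OF x] using no_return[OF cond x] by blast
    show "good_module Q I r (proj_module Q I x)"
      unfolding good_proj_iff[OF x] by (rule ex_good_sequence[OF cond x]) auto
  qed
qed

end

section \<open>Monomial ideals\<close>

context quiver
begin

lemma a_inv_apply:
  fixes f :: "nat list \<Rightarrow> 'k::field"
  assumes "f \<in> carrier (path_algebra Q)"
  shows "\<ominus>\<^bsub>path_algebra Q\<^esub> f = (\<lambda>p. -1 * f p)"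
proof -
  interpret ring "path_algebra Q :: (nat list \<Rightarrow> 'k) ring" by (rule path_algebra_ring)
  show ?thesis
    by (rule minus_equality) (use assms scale_closed[OF assms, of "-1"] in \<open>auto simp: path_algebra_def\<close>)
qed

text \<open>Multiplication prolongs paths at their ends, so a contiguous piece survives.\<close>

lemma monomial_ideal:
  "ideal {f \<in> carrier (path_algebra Q). \<forall>p. f p \<noteq> 0 \<longrightarrow> (\<exists>g\<in>G. sublist g p)}
    (path_algebra Q :: (nat list \<Rightarrow> 'k::field) ring)" (is "ideal ?M ?R")
proof (rule idealI)
  show "ring ?R" by (rule path_algebra_ring)
  show "subgroup ?M (add_monoid ?R)"
  proof
    fix f assume f: "f \<in> ?M"
    then have "inv\<^bsub>add_monoid ?R\<^esub> f = (\<lambda>p. -1 * f p)"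
      using a_inv_apply[of f] by (simp add: a_inv_def)
    then show "inv\<^bsub>add_monoid ?R\<^esub> f \<in> ?M" using f scale_closed[of f Q "-1"] by auto
  next
    fix f g assume "f \<in> ?M" "g \<in> ?M"
    then show "f \<otimes>\<^bsub>add_monoid ?R\<^esub> g \<in> ?M"
      by (simp add: add_closed add_apply) (metis add.right_neutral)
  qed (auto simp: zero_closed zero_apply)
next
  fix f a assume f: "f \<in> ?M" and a: "a \<in> carrier ?R"
  have "\<exists>g\<in>G. sublist g p" if nz: "(a \<otimes>\<^bsub>?R\<^esub> f) p \<noteq> 0" for p
  proof -
    obtain k where "f (take (k + 1) p) \<noteq> 0"
      using nz by (auto simp: path_algebra_def elim!: sum.not_neutral_contains_not_neutral)
    then obtain g where "g \<in> G" "sublist g (take (k + 1) p)" using f by blast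
    then show ?thesis by (meson sublist_order.order.trans sublist_take)
  qed
  then show "a \<otimes>\<^bsub>?R\<^esub> f \<in> ?M" using f a by (simp add: path_algebra_mult_closed)
  have "\<exists>g\<in>G. sublist g p" if nz: "(f \<otimes>\<^bsub>?R\<^esub> a) p \<noteq> 0" for p
  proof -
    obtain k where "f (drop k p) \<noteq> 0"
      using nz by (auto simp: path_algebra_def elim!: sum.not_neutral_contains_not_neutral)
    then obtain g where "g \<in> G" "sublist g (drop k p)" using f by blast
    then show ?thesis by (meson sublist_order.order.trans sublist_drop)
  qed
  then show "f \<otimes>\<^bsub>?R\<^esub> a \<in> ?M" using f a by (simp add: path_algebra_mult_closed)
qed

lemma path_elem_pth_mult:
  "path_elem (pth Q (walk Q x j) l) \<otimes>\<^bsub>path_algebra Q\<^esub> path_elem (pth Q x j) =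
    (path_elem (pth Q x (j + l)) :: nat list \<Rightarrow> 'k::field)"
  using path_elem_mult[of "pth Q x j" "pth Q (walk Q x j) l" Q, where 'k='k] by (simp add: pth_append)

text \<open>The path \<open>p\<close> is \<open>g\<close> with a head before it and a tail after it.
  The scalar is carried by the left factor, because a ring ideal absorbs ring elements.\<close>

lemma path_elem_mem_ideal:
  assumes J: "ideal J (path_algebra Q :: (nat list \<Rightarrow> 'k::field) ring)" and g: "path_elem g \<in> J"
    and paths: "g \<in> paths Q" "p \<in> paths Q" and sub: "sublist g p"
  shows "(\<lambda>q. c * path_elem p q) \<in> J"
proof -
  obtain y l where gy: "g = pth Q y l" using pathsE[OF paths(1)] by metis
  obtain x k where px: "p = pth Q x k" using pathsE[OF paths(2)] by metis
  obtain j where j: "j + l \<le> k" "walk Q x j = y"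
    using sub unfolding gy px sublist_pth_iff by blast
  have xj: "pth Q x j \<in> paths Q" using paths(2) j pth_paths_le[of x k j] by (simp add: px)
  have yk: "pth Q (walk Q x (j + l)) (k - (j + l)) \<in> paths Q"
    using paths(2) j pth_walk_paths[of x k "j + l"] by (simp add: px)
  have "path_elem g \<otimes>\<^bsub>path_algebra Q\<^esub> path_elem (pth Q x j) \<in> J"
    by (rule ideal.I_r_closed[OF J g path_elem_closed[OF xj]])
  then have "path_elem (pth Q x (j + l)) \<in> J"
    using path_elem_pth_mult[of x j l, where 'k='k] by (simp add: gy j(2))
  then have "(\<lambda>q. c * path_elem (pth Q (walk Q x (j + l)) (k - (j + l))) q) \<otimes>\<^bsub>path_algebra Q\<^esub>
      path_elem (pth Q x (j + l)) \<in> J"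
    by (rule ideal.I_l_closed[OF J _ scale_closed[OF path_elem_closed[OF yk]]])
  then show ?thesis
    unfolding scale_mult path_elem_pth_mult using j(1) by (simp add: px)
qed

lemma genideal_paths:
  assumes G: "G \<subseteq> paths Q"
  shows "Idl\<^bsub>path_algebra Q\<^esub> (path_elem ` G) =
    {f \<in> carrier (path_algebra Q :: (nat list \<Rightarrow> 'k::field) ring). \<forall>p. f p \<noteq> 0 \<longrightarrow> (\<exists>g\<in>G. sublist g p)}"
    (is "?I = ?M")
proof
  let ?R = "path_algebra Q :: (nat list \<Rightarrow> 'k) ring"
  interpret R: ring ?R by (rule path_algebra_ring)
  have sub: "path_elem ` G \<subseteq> carrier ?R" using G path_elem_closed by blast
  have I: "ideal ?I ?R" by (rule R.genideal_ideal[OF sub])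
  show "?I \<subseteq> ?M"
    by (rule R.genideal_minimal[OF monomial_ideal]) (use sub in \<open>auto simp: path_elem_def split: if_splits\<close>)
  have "f \<in> ?I" if "f \<in> ?M" for f
    using that
  \<comment> \<open>One monomial is split off at a time.\<close>
  proof (induction "card {p. f p \<noteq> 0}" arbitrary: f rule: less_induct)
    case less
    show ?case
    proof (cases "{p. f p \<noteq> 0} = {}")
      case True
      then have "f = \<zero>\<^bsub>?R\<^esub>" by (auto simp: path_algebra_def)
      then show ?thesis using additive_subgroup.zero_closed[OF ideal.axioms(1)[OF I]] by simp
    next
      case False
      then obtain p where p: "f p \<noteq> 0" by blast
      have fin: "finite {p. f p \<noteq> 0}" using less.prems by (simp add: mem_path_algebra)
      define h where "h = f(p := 0)"
      have supp: "{q. h q \<noteq> 0} = {q. f q \<noteq> 0} - {p}" by (auto simp: h_def)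
      have "h \<in> ?M" using less.prems fin by (auto simp: mem_path_algebra supp) (auto simp: h_def split: if_splits)
      moreover have "card {q. h q \<noteq> 0} < card {q. f q \<noteq> 0}"
        unfolding supp using p fin by (intro card_Diff1_less) auto
      ultimately have "h \<in> ?I" using less.hyps by blast
      moreover have "(\<lambda>q. f p * path_elem p q) \<in> ?I"
      proof -
        obtain g where g: "g \<in> G" "sublist g p" using less.prems p by blast
        have "p \<in> paths Q" using less.prems p by (auto simp: mem_path_algebra)
        then show ?thesis
          using g G R.genideal_self[OF sub] by (intro path_elem_mem_ideal[OF I, of g]) auto
      qed
      ultimately have "h \<oplus>\<^bsub>?R\<^esub> (\<lambda>q. f p * path_elem p q) \<in> ?I"
        by (rule additive_subgroup.a_closed[OF ideal.axioms(1)[OF I]])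
      moreover have "h \<oplus>\<^bsub>?R\<^esub> (\<lambda>q. f p * path_elem p q) = f"
        by (rule ext) (simp add: add_apply h_def path_elem_def)
      ultimately show ?thesis by simp
    qed
  qed
  then show "?M \<subseteq> ?I" by blast
qed

lemma mem_arrow_ideal_iff:
  "f \<in> (arrow_ideal Q :: (nat list \<Rightarrow> 'k::field) set) \<longleftrightarrow>
    f \<in> carrier (path_algebra Q) \<and> (\<forall>x. f [x] = 0)"
proof -
  let ?G = "{[i, j] |i j. (i, j) \<in> arrows Q}"
  have arrow: "[x, walk Q x 1] = pth Q x 1" for x by (simp add: pth_def)
  have "?G \<subseteq> paths Q" by (auto simp: paths_def arrows_iff)
  moreover have "{path_elem [i, j] :: _ \<Rightarrow> 'k |i j. (i, j) \<in> arrows Q} = path_elem ` ?G" by blast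
  ultimately have "f \<in> arrow_ideal Q \<longleftrightarrow>
      f \<in> carrier (path_algebra Q) \<and> (\<forall>p. f p \<noteq> 0 \<longrightarrow> (\<exists>g\<in>?G. sublist g p))"
    by (simp only: arrow_ideal_def genideal_paths mem_Collect_eq)
  also have "\<dots> \<longleftrightarrow> f \<in> carrier (path_algebra Q) \<and> (\<forall>x. f [x] = 0)"
  proof (intro conj_cong refl iffI allI impI)
    fix x assume *: "\<forall>p. f p \<noteq> 0 \<longrightarrow> (\<exists>g\<in>?G. sublist g p)"
    have "\<not> sublist g [x]" if "g \<in> ?G" for g
      using that sublist_length_le[of g "[x]"] by auto
    then show "f [x] = 0" using * by blast
  next
    fix p assume f: "f \<in> carrier (path_algebra Q)" and *: "\<forall>x. f [x] = 0" and nz: "f p \<noteq> 0"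
    then have path: "p \<in> paths Q" by (auto simp: mem_path_algebra)
    then obtain x k where p: "p = pth Q x k" using pathsE by metis
    have "k \<noteq> 0" using nz * p by (cases k) auto
    then have "pth Q x 1 \<in> paths Q" "sublist (pth Q x 1) p"
      using path pth_paths_le[of x k 1] unfolding p sublist_pth_iff by (auto intro: exI[of _ 0])
    moreover from this(1) have "(x, walk Q x 1) \<in> arrows Q"
      by (simp add: pth_in_paths_iff arrows_iff walk_Suc)
    ultimately show "\<exists>g\<in>?G. sublist g p" unfolding arrow[symmetric] by blast
  qed
  finally show ?thesis .
qed

section \<open>Powers of the arrow ideal\<close>

lemma ideal_arrow_ideal: "ideal (arrow_ideal Q) (path_algebra Q :: (nat list \<Rightarrow> 'k::field) ring)"
proof -
  interpret R: ring "path_algebra Q :: (nat list \<Rightarrow> 'k) ring" by (rule path_algebra_ring)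
  show ?thesis
    unfolding arrow_ideal_def
    by (rule R.genideal_ideal) (auto simp: paths_def arrows_iff intro!: path_elem_closed)
qed

text \<open>This puts an admissible ideal inside the arrow ideal, which keeps the trivial paths out
  of it and the projectives nonzero.\<close>

lemma arrow_ideal_square_subset:
  "arrow_ideal Q [^]\<^bsub>ideals_set (path_algebra Q :: (nat list \<Rightarrow> 'k::field) ring)\<^esub> (2::nat) \<subseteq> arrow_ideal Q"
proof -
  interpret R: ring "path_algebra Q :: (nat list \<Rightarrow> 'k) ring" by (rule path_algebra_ring)
  note J = ideal_arrow_ideal[where 'k='k]
  show ?thesis
    using R.ideal_prod_inter[OF R.ideal_prod_is_ideal[OF R.oneideal J] J]
    by (simp add: nat_pow_def ideals_set_def numeral_2_eq_2)
qed

text \<open>The first arrow is split off as the right factor, in accordance with how the power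
  unfolds.\<close>

lemma path_elem_mem_arrow_ideal_power:
  assumes "pth Q x m \<in> paths Q"
  shows "path_elem (pth Q x m) \<in> arrow_ideal Q [^]\<^bsub>ideals_set (path_algebra Q :: (nat list \<Rightarrow> 'k::field) ring)\<^esub> m"
  using assms
proof (induction m arbitrary: x)
  case 0
  then show ?case using path_elem_closed[OF 0] by (simp add: nat_pow_def ideals_set_def)
next
  case (Suc m)
  have "pth Q (walk Q x 1) m \<in> paths Q" using pth_walk_paths[OF Suc.prems, of 1] by simp
  note 1 = Suc.IH[OF this]
  have "path_elem (pth Q x 1) \<in> (arrow_ideal Q :: (nat list \<Rightarrow> 'k) set)"
    using path_elem_closed[OF pth_paths_le[OF Suc.prems, of 1]]
    by (simp add: mem_arrow_ideal_iff) (simp add: path_elem_def pth_def)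
  from ideal_prod.prod[OF 1 this, of "path_algebra Q"]
  show ?case
    unfolding path_elem_pth_mult by (simp add: nat_pow_def ideals_set_def)
qed

end

section \<open>Minimal generators\<close>

locale nakayama_algebra = quiver +
  fixes I :: "(nat list \<Rightarrow> 'k::field) set" and G :: "nat list set"
  assumes admissible: "admissible Q I" and minimal: "minimal_generating_paths Q I G"
begin

lemma G_paths: "G \<subseteq> paths Q"
  using minimal by (simp add: minimal_generating_paths_def)

lemma mem_I_iff: "f \<in> I \<longleftrightarrow> f \<in> carrier (path_algebra Q) \<and> (\<forall>p. f p \<noteq> 0 \<longrightarrow> (\<exists>g\<in>G. sublist g p))"
proof -
  have "I = Idl\<^bsub>path_algebra Q\<^esub> (path_elem ` G)"
    using minimal by (simp add: minimal_generating_paths_def)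
  then show ?thesis by (simp add: genideal_paths[OF G_paths])
qed

lemma path_elem_mem_I_iff:
  "p \<in> paths Q \<Longrightarrow> path_elem p \<in> I \<longleftrightarrow> (\<exists>g\<in>G. sublist g p)"
  using path_elem_closed[of p Q, where 'a='k] by (auto simp: mem_I_iff path_elem_def)

text \<open>This is the function that instantiates \<open>L\<close>. A walk stops at the end of the
  linear quiver or at the first path divisible by a generator; at non-vertices the value is
  \<open>0\<close>.\<close>

definition reduced_length :: "nat \<Rightarrow> nat" where
  "reduced_length x = (LEAST k. pth Q x k \<notin> paths Q \<or> (\<exists>g\<in>G. sublist g (pth Q x k)))"

lemma reduced_length_le:
  "pth Q x k \<notin> paths Q \<or> (\<exists>g\<in>G. sublist g (pth Q x k)) \<Longrightarrow> reduced_length x \<le> k"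
  unfolding reduced_length_def by (rule Least_le)

lemma below_reduced_length:
  assumes "k < reduced_length x"
  shows "pth Q x k \<in> paths Q" "g \<in> G \<Longrightarrow> \<not> sublist g (pth Q x k)"
  using assms not_less_Least unfolding reduced_length_def by blast+

lemma reduced_length_generator:
  assumes "pth Q x (reduced_length x) \<in> paths Q"
  shows "\<exists>g\<in>G. sublist g (pth Q x (reduced_length x))"
proof -
  \<comment> \<open>A power of the arrow ideal inside \<open>I\<close> guarantees that the walk
    stops, so the least index is attained.\<close>
  obtain m :: nat where "arrow_ideal Q [^]\<^bsub>ideals_set (path_algebra Q)\<^esub> m \<subseteq> I"
    using admissible by (auto simp: admissible_def)
  then have "pth Q x m \<notin> paths Q \<or> (\<exists>g\<in>G. sublist g (pth Q x m))"
    using path_elem_mem_arrow_ideal_power path_elem_mem_I_iff by blast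
  from LeastI[of "\<lambda>k. pth Q x k \<notin> paths Q \<or> (\<exists>g\<in>G. sublist g (pth Q x k))", OF this]
  show ?thesis using assms unfolding reduced_length_def by blast
qed

lemma reduced_length_pos:
  assumes x: "x \<in> verts Q"
  shows "0 < reduced_length x"
proof (rule ccontr)
  assume "\<not> 0 < reduced_length x"
  moreover have path: "[x] \<in> paths Q" using x by (simp add: paths_def)
  ultimately have "\<exists>g\<in>G. sublist g [x]" using reduced_length_generator[of x] by simp
  then have "path_elem [x] \<in> I" by (simp only: path_elem_mem_I_iff[OF path])
  then have "path_elem [x] \<in> (arrow_ideal Q :: (nat list \<Rightarrow> 'k) set)"
    using admissible arrow_ideal_square_subset unfolding admissible_def by blast
  then have "path_elem [x] [x] = (0 :: 'k)" by (simp only: mem_arrow_ideal_iff)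
  then show False by (simp add: path_elem_def)
qed

text \<open>A generator containing another one could be dropped without changing the ideal, against
  minimality.\<close>

lemma generator_antichain:
  assumes g: "g \<in> G" "g' \<in> G" and sub: "sublist g' g"
  shows "g' = g"
proof (rule ccontr)
  assume "g' \<noteq> g"
  have "(\<exists>h\<in>G - {g}. sublist h p) \<longleftrightarrow> (\<exists>h\<in>G. sublist h p)" for p
    using g sub \<open>g' \<noteq> g\<close> by (metis DiffD1 DiffI singletonD sublist_order.order.trans)
  then have "I = Idl\<^bsub>path_algebra Q\<^esub> (path_elem ` (G - {g}))"
    using genideal_paths[of "G - {g}", where 'k='k] G_paths by (subst genideal_paths) (auto simp: mem_I_iff)
  moreover have "G - {g} \<subset> G" using g by blast
  ultimately show False using minimal by (auto simp: minimal_generating_paths_def)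
qed

text \<open>By the antichain property, a piece of \<open>g\<close> that contains a generator is all
  of \<open>g\<close>. For initial segments this gives the length, for final segments the
  inequality.\<close>

lemma generator_form:
  assumes g: "g \<in> G"
  shows "\<exists>x\<in>verts Q. g = pth Q x (reduced_length x) \<and> g \<in> paths Q \<and>
    (\<forall>j. 0 < j \<longrightarrow> j \<le> reduced_length x \<longrightarrow> reduced_length x < j + reduced_length (walk Q x j))"
proof -
  have path: "g \<in> paths Q" using g G_paths by blast
  then obtain x k where gx: "g = pth Q x k" using pathsE by metis
  have eq: "l = k" if p: "pth Q y l \<in> paths Q" and h: "h \<in> G" "sublist h (pth Q y l)" and sub: "sublist (pth Q y l) g"
    for y l h
  proof -
    have "h = g" by (rule generator_antichain[OF g h(1)]) (rule sublist_order.order.trans[OF h(2) sub])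
    then show "l = k"
      using sublist_length_le[OF h(2)] sublist_length_le[OF sub] by (simp add: gx)
  qed
  have le: "reduced_length x \<le> k"
    by (rule reduced_length_le) (use g gx in auto)
  have px: "pth Q x (reduced_length x) \<in> paths Q"
    using path le pth_paths_le unfolding gx by blast
  obtain h where h: "h \<in> G" "sublist h (pth Q x (reduced_length x))"
    using reduced_length_generator[OF px] by blast
  have "sublist (pth Q x (reduced_length x)) g"
    unfolding gx sublist_pth_iff using le by (intro exI[of _ 0]) simp
  then have k: "reduced_length x = k" by (rule eq[OF px h])
  have "k < j + reduced_length (walk Q x j)" if j: "0 < j" "j \<le> k" for j
  proof (rule ccontr)
    let ?y = "walk Q x j"
    assume "\<not> k < j + reduced_length ?y"
    then have le: "reduced_length ?y \<le> k - j" using j by simp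
    then have p: "pth Q ?y (reduced_length ?y) \<in> paths Q"
      using pth_paths_le[OF pth_walk_paths[of x k j]] path j gx by blast
    obtain h where h: "h \<in> G" "sublist h (pth Q ?y (reduced_length ?y))"
      using reduced_length_generator[OF p] by blast
    have "sublist (pth Q ?y (reduced_length ?y)) g"
      unfolding gx sublist_pth_iff using le j by (intro exI[of _ j]) simp
    then have "reduced_length ?y = k" by (rule eq[OF p h])
    then show False using le j by simp
  qed
  moreover have "x \<in> verts Q" using path by (simp add: gx pth_in_paths_iff)
  ultimately show ?thesis using path gx k by (intro bexI[of _ x]) auto
qed

text \<open>A generator ending earlier would make a shorter path from \<open>x\<close> zero, so it
  must be a final segment.\<close>

lemma generator_in_relation:
  assumes p: "pth Q x (reduced_length x) \<in> paths Q"
  shows "\<exists>j\<le>reduced_length x. pth Q (walk Q x j) (reduced_length x - j) \<in> G"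
proof -
  obtain g where g: "g \<in> G" "sublist g (pth Q x (reduced_length x))"
    using reduced_length_generator[OF p] by blast
  then obtain y l where gy: "g = pth Q y l" using pathsE G_paths by (metis subsetD)
  obtain j where j: "j + l \<le> reduced_length x" "walk Q x j = y"
    using g(2) unfolding gy sublist_pth_iff by blast
  have "sublist g (pth Q x (j + l))" unfolding gy sublist_pth_iff using j by blast
  then have "reduced_length x \<le> j + l" using g(1) by (intro reduced_length_le) blast
  then have "l = reduced_length x - j" using j by simp
  then show ?thesis using g(1) j gy by (intro exI[of _ j]) auto
qed

lemma ideal_I: "ideal I (path_algebra Q)"
  using admissible by (simp add: admissible_def)

text \<open>A zero path stays zero when prolonged, so the zero paths from \<open>x\<close> are those
  with at least \<open>reduced_length x\<close> arrows.\<close>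

lemma mem_I_iff_coeffs:
  assumes f: "f \<in> carrier (path_algebra Q)"
  shows "f \<in> I \<longleftrightarrow> (\<forall>x k. k < reduced_length x \<longrightarrow> f (pth Q x k) = 0)"
proof
  assume "f \<in> I"
  then show "\<forall>x k. k < reduced_length x \<longrightarrow> f (pth Q x k) = 0"
    using below_reduced_length(2) by (auto simp: mem_I_iff)
next
  assume *: "\<forall>x k. k < reduced_length x \<longrightarrow> f (pth Q x k) = 0"
  have "\<exists>g\<in>G. sublist g p" if nz: "f p \<noteq> 0" for p
  proof -
    have path: "p \<in> paths Q" using f nz by (auto simp: mem_path_algebra)
    then obtain x k where p: "p = pth Q x k" using pathsE by metis
    have le: "reduced_length x \<le> k" using * nz p not_less by blast
    then have "\<exists>g\<in>G. sublist g (pth Q x (reduced_length x))"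
      using path pth_paths_le unfolding p by (intro reduced_length_generator) blast
    moreover have "sublist (pth Q x (reduced_length x)) p"
      unfolding p sublist_pth_iff using le by (intro exI[of _ 0]) simp
    ultimately show ?thesis by (meson sublist_order.order.trans)
  qed
  then show "f \<in> I" using f by (simp add: mem_I_iff)
qed

end

theorem theorem3p3:
  fixes n :: nat
    and Q :: nak_quiver
    and I :: "(nat list \<Rightarrow> 'k::alg_closed_field) set"
    and G :: "nat list set"
    and r :: "(nat \<times> nat) set"
  assumes "n \<ge> 2"
    and "Q = LinearA n \<or> Q = CyclicA n"
    and "admissible Q I"
    and "minimal_generating_paths Q I G"
    and "linear_order_on (verts Q) r"
  shows "q_ordering Q I r \<longleftrightarrow> (\<forall>g\<in>G. max_wrt r (Hod g) \<notin># Interior g)"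
proof -
  interpret N: nakayama_algebra Q n I G
    by standard (use assms in auto)
  interpret W: nakayama_generators Q n I N.reduced_length r G
  proof (intro nakayama_generators.intro nakayama_ordered.intro nakayama_basis.intro nakayama.intro
      nakayama_generators_axioms.intro nakayama_ordered_axioms.intro nakayama_basis_axioms.intro
      nakayama_axioms.intro)
    show "pth Q x k \<in> paths Q" if "x \<in> verts Q" "k < N.reduced_length x" for x k
      using that(2) by (rule N.below_reduced_length)
  qed (fact N.quiver_axioms N.ideal_I N.mem_I_iff_coeffs N.reduced_length_pos N.mem_arrow_ideal_iff
      assms(5) N.generator_form N.generator_in_relation)+
  show ?thesis by (rule W.q_ordering_iff)
qed

end
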